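(* Let $G$ be a closed oligomorphic subgroup of $S_\infty$ with ample generic elements. Then $G$ has the Bergman property.
   Context: $S_\infty$ is the Polish group of all permutations of $\mathbb N$ with the pointwise convergence topology. A subgroup $G\leq S_\infty$ is oligomorphic if it has only finitely many orbits on $\mathbb N^n$ for each $n$. A Polish group $G$ has ample generic elements if for each finite $n\ge 1$ there is a comeager orbit for the diagonal conjugacy action of $G$ on $G^n$, $g\cdot(g_1,\dots,g_n)=(gg_1g^{-1},\dots,gg_ng^{-1})$. A group $G$ has the Bergman property if for each exhaustive sequence of subsets $W_0\subseteq W_1\subseteq W_2\subseteq\dots\subseteq G$ (i.e. $\bigcup_nW_n=G$) there are $n$ and $k$ such that $W_n^k=G$, where $W^k$ is the set of products of $k$ elements of $W$. *)

theory Defs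
  imports
    "HOL-Analysis.Analysis"
    "HOL-Algebra.Bij"
    "HOL-Algebra.Coset"
    "HOL-Algebra.Group_Action"
begin

definition nowhere_dense_in :: "'a topology \<Rightarrow> 'a set \<Rightarrow> bool" where
  "nowhere_dense_in X S \<longleftrightarrow> S \<subseteq> topspace X \<and> X interior_of (X closure_of S) = {}"

definition meager_in :: "'a topology \<Rightarrow> 'a set \<Rightarrow> bool" where
  "meager_in X S \<longleftrightarrow> (\<exists>N :: nat \<Rightarrow> 'a set. (\<forall>i. nowhere_dense_in X (N i)) \<and> S = (\<Union>i. N i))"

definition comeager_in :: "'a topology \<Rightarrow> 'a set \<Rightarrow> bool" where
  "comeager_in X S \<longleftrightarrow> S \<subseteq> topspace X \<and> meager_in X (topspace X - S)"

text \<open>Multiplication in \<open>S_inf\<close> is \<open>g \<otimes> f = g \<circ> f\<close>. The extensionality condition in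
  \<^const>\<open>BijGroup\<close> is vacuous here, so the carrier is \<open>{f. bij f}\<close>.\<close>

definition S_inf :: "(nat \<Rightarrow> nat) monoid" where
  "S_inf = BijGroup UNIV"

text \<open>The type \<^typ>\<open>nat\<close> is discrete and the function type \<^typ>\<open>nat \<Rightarrow> nat\<close> carries the product
  topology, so the subspace topology on the carrier is pointwise convergence.\<close>

definition closed_subgroup_S_inf :: "(nat \<Rightarrow> nat) set \<Rightarrow> bool" where
  "closed_subgroup_S_inf G \<longleftrightarrow>
     subgroup G S_inf \<and> closedin (top_of_set (carrier S_inf)) G"

abbreviation subgroup_monoid :: "(nat \<Rightarrow> nat) set \<Rightarrow> (nat \<Rightarrow> nat) monoid" where
  "subgroup_monoid G \<equiv> S_inf\<lparr>carrier := G\<rparr>"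

text \<open>Elements of \<open>\<nat>\<^sup>n\<close> are lists of length \<open>n\<close>, with the coordinatewise action
  \<^const>\<open>map\<close>.\<close>

definition oligomorphic :: "(nat \<Rightarrow> nat) set \<Rightarrow> bool" where
  "oligomorphic G \<longleftrightarrow>
     (\<forall>n. finite (orbits (subgroup_monoid G) {xs :: nat list. length xs = n} map))"

text \<open>Elements of \<open>G\<^sup>n\<close> are functions on \<open>{..<n}\<close>, extended by \<^const>\<open>undefined\<close>; this is the
  carrier of \<^const>\<open>product_topology\<close>.\<close>

definition diag_conj ::
  "('a, 'b) monoid_scheme \<Rightarrow> nat \<Rightarrow> 'a \<Rightarrow> (nat \<Rightarrow> 'a) \<Rightarrow> (nat \<Rightarrow> 'a)" where
  "diag_conj G n g x = (\<lambda>i\<in>{..<n}. g \<otimes>\<^bsub>G\<^esub> x i \<otimes>\<^bsub>G\<^esub> inv\<^bsub>G\<^esub> g)"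

text \<open>Intended for a group \<open>G\<close> with a Polish group topology \<open>T\<close> on its carrier. For a closed
  subgroup of \<open>S_inf\<close> with the subspace topology, Polishness is automatic.\<close>

definition ample_generics :: "('a, 'b) monoid_scheme \<Rightarrow> 'a topology \<Rightarrow> bool" where
  "ample_generics G T \<longleftrightarrow>
     (\<forall>n\<ge>1. \<exists>C \<in> orbits G ({..<n} \<rightarrow>\<^sub>E carrier G) (diag_conj G n).
        comeager_in (product_topology (\<lambda>_. T) {..<n}) C)"

primrec set_power :: "('a, 'b) monoid_scheme \<Rightarrow> 'a set \<Rightarrow> nat \<Rightarrow> 'a set" where
  "set_power G W 0 = {\<one>\<^bsub>G\<^esub>}"
| "set_power G W (Suc k) = set_power G W k <#>\<^bsub>G\<^esub> W"

definition bergman_property :: "('a, 'b) monoid_scheme \<Rightarrow> bool" where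
  "bergman_property G \<longleftrightarrow>
     (\<forall>W :: nat \<Rightarrow> 'a set. (\<forall>n. W n \<subseteq> W (Suc n)) \<and> (\<Union>n. W n) = carrier G \<longrightarrow>
        (\<exists>n k. set_power G (W n) k = carrier G))"

end

theory Submission
  imports Defs
begin

text \<open>
  The argument is due to Kechris and Rosendal. Let \<open>W\<^sub>0 \<subseteq> W\<^sub>1 \<subseteq> \<dots>\<close> exhaust \<open>G\<close>. Passing to
  \<open>{w. w \<in> W\<^sub>n \<and> w\<inverse> \<in> W\<^sub>n}\<close>, which still exhausts \<open>G\<close>, one may assume that every \<open>W\<^sub>n\<close> is closed
  under inverses. It suffices to find an open subgroup \<open>V\<close> inside \<open>W\<^sub>n\<^sup>1\<^sup>0\<close> for some \<open>n\<close>: since \<open>G\<close> is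
  oligomorphic, \<open>G = V F V\<close> for a finite set \<open>F\<close> (\<open>oligomorphic_double_cosets\<close>), and \<open>F\<close>
  lies in some \<open>W\<^sub>N\<close> with \<open>N \<ge> n\<close>, so that \<open>G = W\<^sub>N\<^sup>2\<^sup>1\<close>.

  Suppose that no \<open>W\<^sub>n\<^sup>1\<^sup>0\<close> contains an open subgroup. As \<open>G\<close> is a Baire space, all \<open>W\<^sub>n\<close> may be
  assumed nonmeager; and the complement of \<open>W\<^sub>n\<^sup>5\<close> is nonmeager in every nonempty open set, because
  otherwise Pettis' argument (\<open>Pettis_stab\<close>) finds an open subgroup inside
  \<open>(W\<^sub>n\<^sup>5)\<inverse> W\<^sub>n\<^sup>5 = W\<^sub>n\<^sup>1\<^sup>0\<close>. Ample generics now give elements \<open>h\<^sub>a \<in> G\<close>, indexed by infinite binary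
  sequences, such that the conjugate of \<open>W\<^sub>n\<close> by \<open>h\<^sub>a\<close> meets the conjugate of \<open>G - W\<^sub>n\<^sup>5\<close> by
  \<open>h\<^sub>b\<close> whenever \<open>a\<close> and \<open>b\<close> first differ at place \<open>n\<close>, where \<open>a\<close> has 0 and \<open>b\<close> has 1
  (\<open>tree_of_conjugators\<close>). There are uncountably many sequences, so two of those whose \<open>h\<close> lies in a
  single \<open>W\<^sub>m\<close> agree up to \<open>m\<close>. They first differ at some \<open>n \<ge> m\<close>, and \<open>h\<^sub>a, h\<^sub>b \<in> W\<^sub>n\<close> puts an element
  of \<open>h\<^sub>b\<inverse> h\<^sub>a W\<^sub>n h\<^sub>a\<inverse> h\<^sub>b \<subseteq> W\<^sub>n\<^sup>5\<close> outside \<open>W\<^sub>n\<^sup>5\<close> (\<open>stab_subset_products\<close>).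

  The tree is built by extending generic tuples one coordinate at a time. By Kuratowski and Ulam,
  if \<open>x\<close> is generic then so is \<open>(x, y)\<close> for comeagerly many \<open>y\<close>; hence \<open>y\<^sub>0\<close> can be found in a given
  nonmeager set and \<open>y\<^sub>1\<close> in a given everywhere nonmeager set, with \<open>y\<^sub>1\<close> as close to \<open>y\<^sub>0\<close> as desired.
  Both \<open>(x, y\<^sub>0)\<close> and \<open>(x, y\<^sub>1)\<close> lie in the comeager orbit, and Effros' theorem
  (\<open>Effros_conj_orbit\<close>) makes them conjugate by an element close to the identity
  (\<open>generic_append_pair\<close>). The product of these small corrections along a branch \<open>a\<close> converges to
  \<open>h\<^sub>a\<close>.
\<close>

\<comment> \<open>Below, \<open>inv\<close> always means the inverse of a function and \<open>closure_of\<close> the topological closure.\<close>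
unbundle no m_inv_syntax
no_notation eq_closure_of (\<open>closure'_of\<index>\<close>)

section \<open>Baire category\<close>

lemma nowhere_dense_in_subset:
  assumes "nowhere_dense_in X S" "S' \<subseteq> S"
  shows "nowhere_dense_in X S'"
  using assms interior_of_mono[OF closure_of_mono[OF assms(2)], of X]
  unfolding nowhere_dense_in_def by blast

lemma meager_in_subset:
  assumes "meager_in X S" "S' \<subseteq> S"
  shows "meager_in X S'"
proof -
  obtain N :: "nat \<Rightarrow> 'a set" where N: "\<And>i. nowhere_dense_in X (N i)" "S = (\<Union>i. N i)"
    using assms(1) by (auto simp: meager_in_def)
  have "S' = (\<Union>i. N i \<inter> S')"
    using assms(2) N(2) by auto
  moreover have "nowhere_dense_in X (N i \<inter> S')" for i
    using N(1) nowhere_dense_in_subset by blast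
  ultimately show ?thesis
    unfolding meager_in_def by (intro exI[of _ "\<lambda>i. N i \<inter> S'"]) simp
qed

lemma meager_in_Union:
  assumes "countable \<S>" "\<And>S. S \<in> \<S> \<Longrightarrow> meager_in X S"
  shows "meager_in X (\<Union>\<S>)"
proof (cases "\<S> = {}")
  case True
  have "nowhere_dense_in X {}"
    by (simp add: nowhere_dense_in_def)
  then show ?thesis
    unfolding meager_in_def True by (intro exI[of _ "\<lambda>_. {}"]) simp
next
  case False
  have "\<forall>S\<in>\<S>. \<exists>N :: nat \<Rightarrow> 'a set. (\<forall>i. nowhere_dense_in X (N i)) \<and> S = (\<Union>i. N i)"
    using assms(2) by (simp add: meager_in_def)
  then obtain N :: "'a set \<Rightarrow> nat \<Rightarrow> 'a set"
    where N: "\<And>S i. S \<in> \<S> \<Longrightarrow> nowhere_dense_in X (N S i)" "\<And>S. S \<in> \<S> \<Longrightarrow> S = (\<Union>i. N S i)"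
    by metis
  define M where "M = (\<lambda>k. N (from_nat_into \<S> (fst (prod_decode k))) (snd (prod_decode k)))"
  have ran: "from_nat_into \<S> k \<in> \<S>" for k
    using False by (rule from_nat_into)
  have "\<Union>\<S> = (\<Union>k. M k)"
  proof
    show "\<Union>\<S> \<subseteq> (\<Union>k. M k)"
    proof
      fix x assume "x \<in> \<Union>\<S>"
      then obtain S i where S: "S \<in> \<S>" "x \<in> N S i"
        using N(2) by blast
      obtain j where j: "S = from_nat_into \<S> j"
        using S(1) assms(1) from_nat_into_surj by metis
      have "x \<in> M (prod_encode (j, i))"
        using S j by (simp add: M_def)
      then show "x \<in> (\<Union>k. M k)" by blast
    qed
    show "(\<Union>k. M k) \<subseteq> \<Union>\<S>"
      using ran N(2) unfolding M_def by blast
  qed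
  moreover have "nowhere_dense_in X (M k)" for k
    using N(1) ran by (simp add: M_def)
  ultimately show ?thesis
    unfolding meager_in_def by blast
qed

lemma meager_in_Un:
  assumes "meager_in X S" "meager_in X S'"
  shows "meager_in X (S \<union> S')"
  using meager_in_Union[of "{S, S'}" X] assms by auto

lemma meager_in_homeomorphic_image:
  assumes "homeomorphic_map X Y f" "meager_in X S"
  shows "meager_in Y (f ` S)"
proof -
  obtain N :: "nat \<Rightarrow> 'a set" where N: "\<And>i. nowhere_dense_in X (N i)" "S = (\<Union>i. N i)"
    using assms(2) by (auto simp: meager_in_def)
  have "nowhere_dense_in Y (f ` N i)" for i
  proof -
    have "N i \<subseteq> topspace X" "X interior_of (X closure_of N i) = {}"
      using N(1) by (auto simp: nowhere_dense_in_def)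
    moreover have "X closure_of N i \<subseteq> topspace X"
      by (rule closure_of_subset_topspace)
    ultimately have "Y interior_of (Y closure_of f ` N i) = f ` {}"
      by (simp add: homeomorphic_map_closure_of[OF assms(1)] homeomorphic_map_interior_of[OF assms(1)])
    moreover have "f ` N i \<subseteq> topspace Y"
      using \<open>N i \<subseteq> topspace X\<close> homeomorphic_imp_surjective_map[OF assms(1)] by blast
    ultimately show ?thesis
      by (simp add: nowhere_dense_in_def)
  qed
  then show ?thesis
    using N(2) unfolding meager_in_def by (intro exI[of _ "\<lambda>i. f ` N i"]) auto
qed

text \<open>This is the Baire category theorem, phrased for relatively open sets.\<close>

lemma not_meager_in_openin:
  assumes "completely_metrizable_space X" "openin X U" "U \<noteq> {}"
  shows "\<not> meager_in X U"
proof
  assume "meager_in X U"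
  then obtain N :: "nat \<Rightarrow> 'a set" where N: "\<And>i. nowhere_dense_in X (N i)" "U = (\<Union>i. N i)"
    by (auto simp: meager_in_def)
  have "X interior_of \<Union>(range (\<lambda>i. X closure_of N i)) = {}"
    by (rule Baire_category_alt) (use assms(1) N(1) in \<open>auto simp: nowhere_dense_in_def\<close>)
  moreover have "N i \<subseteq> X closure_of N i" for i
    using N(1) by (intro closure_of_subset) (simp add: nowhere_dense_in_def)
  then have "U \<subseteq> \<Union>(range (\<lambda>i. X closure_of N i))"
    unfolding N(2) by auto
  then have "U \<subseteq> X interior_of \<Union>(range (\<lambda>i. X closure_of N i))"
    using assms(2) by (rule interior_of_maximal)
  ultimately show False
    using assms(3) by simp
qed

text \<open>
  For nowhere dense \<open>N\<close>, a fibre of the closure of \<open>N\<close> can only have interior by containing a basic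
  open set \<open>U\<close>. For each \<open>U\<close>, the points with this property form a closed set, and an open set of such
  points would produce an open box inside the closure. As there are countably
  many \<open>U\<close>, the exceptional points form a meager set.
\<close>

lemma Kuratowski_Ulam_meager:
  fixes X :: "'a topology" and Y :: "'b topology"
  assumes \<B>: "countable \<B>" "\<And>U. U \<in> \<B> \<Longrightarrow> openin Y U \<and> U \<noteq> {}"
    and \<B>_base: "\<And>V. openin Y V \<Longrightarrow> V \<noteq> {} \<Longrightarrow> \<exists>U\<in>\<B>. U \<subseteq> V"
    and N: "meager_in (prod_topology X Y) N"
  shows "meager_in X {x \<in> topspace X. \<not> meager_in Y {y. (x, y) \<in> N}}"
proof -
  let ?Z = "prod_topology X Y"
  obtain F :: "nat \<Rightarrow> ('a \<times> 'b) set" where F: "\<And>i. nowhere_dense_in ?Z (F i)" "N = (\<Union>i. F i)"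
    using N by (auto simp: meager_in_def)
  define K where "K i = ?Z closure_of F i" for i
  have K: "closedin ?Z (K i)" "F i \<subseteq> K i" "?Z interior_of K i = {}" "F i \<subseteq> topspace ?Z" for i
    using F(1)[of i] closure_of_subset[of "F i" ?Z] by (auto simp: nowhere_dense_in_def K_def)
  define bad where "bad i U = {x \<in> topspace X. \<forall>y\<in>U. (x, y) \<in> K i}" for i U
  \<comment> \<open>The exceptional points are those whose fibre over some \<open>K i\<close> swallows a basic open set.\<close>
  have bad: "nowhere_dense_in X (bad i U)" if "U \<in> \<B>" for i U
  proof -
    have U: "openin Y U" "U \<noteq> {}" "U \<subseteq> topspace Y"
      using \<B>(2)[OF that] openin_subset by auto
    have "bad i U = (\<Inter>y\<in>U. {x \<in> topspace X. (x, y) \<in> K i})"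
      using U(2) by (auto simp: bad_def)
    moreover have "closedin X {x \<in> topspace X. (x, y) \<in> K i}" if "y \<in> U" for y
    proof -
      have "continuous_map X ?Z (\<lambda>x. (x, y))"
        using that U(3) by (auto intro!: continuous_map_pairedI)
      then show ?thesis
        using K(1) closedin_continuous_map_preimage by fastforce
    qed
    ultimately have closed: "closedin X (bad i U)"
      using U(2) by auto
    have "X interior_of bad i U = {}"
    proof (rule ccontr)
      let ?O = "X interior_of bad i U"
      assume ne: "?O \<noteq> {}"
      have "openin ?Z (?O \<times> U)"
        using U(1) by (simp add: openin_prod_Times_iff)
      moreover have "?O \<times> U \<subseteq> K i"
        using interior_of_subset[of X "bad i U"] by (auto simp: bad_def)
      ultimately have "?O \<times> U \<subseteq> ?Z interior_of K i"
        by (simp add: interior_of_maximal)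
      then show False
        using K(3) ne U(2) by auto
    qed
    then show ?thesis
      using closed closedin_subset by (auto simp: nowhere_dense_in_def closure_of_closedin)
  qed
  have meager: "meager_in X (\<Union>((\<lambda>(i, U). bad i U) ` (UNIV \<times> \<B>)))"
  proof (rule meager_in_Union)
    show "countable ((\<lambda>(i, U). bad i U) ` ((UNIV::nat set) \<times> \<B>))"
      using \<B>(1) by auto
  next
    fix S assume "S \<in> (\<lambda>(i, U). bad i U) ` (UNIV \<times> \<B>)"
    then have "nowhere_dense_in X S"
      using bad by auto
    then show "meager_in X S"
      unfolding meager_in_def by (intro exI[of _ "\<lambda>_. S"]) simp
  qed
  have "{x \<in> topspace X. \<not> meager_in Y {y. (x, y) \<in> N}} \<subseteq> \<Union>((\<lambda>(i, U). bad i U) ` (UNIV \<times> \<B>))"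
  proof (rule subsetI, rule ccontr)
    fix x assume x: "x \<in> {x \<in> topspace X. \<not> meager_in Y {y. (x, y) \<in> N}}"
      and good: "x \<notin> \<Union>((\<lambda>(i, U). bad i U) ` (UNIV \<times> \<B>))"
    have "nowhere_dense_in Y {y. (x, y) \<in> F i}" for i
    proof -
      let ?S = "{y \<in> topspace Y. (x, y) \<in> K i}"
      have "continuous_map Y ?Z (\<lambda>y. (x, y))"
        using x by (auto intro!: continuous_map_pairedI)
      then have cl: "closedin Y ?S"
        using K(1) closedin_continuous_map_preimage by fastforce
      have "Y interior_of ?S = {}"
      proof (rule ccontr)
        assume "Y interior_of ?S \<noteq> {}"
        then obtain U where "U \<in> \<B>" "U \<subseteq> Y interior_of ?S"
          using \<B>_base[of "Y interior_of ?S"] by auto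
        then have "x \<in> bad i U"
          using x interior_of_subset[of Y ?S] by (auto simp: bad_def)
        then show False
          using good \<open>U \<in> \<B>\<close> by auto
      qed
      then have "nowhere_dense_in Y ?S"
        using cl by (auto simp: nowhere_dense_in_def closure_of_closedin)
      moreover have "{y. (x, y) \<in> F i} \<subseteq> ?S"
        using K(2,4)[of i] by auto
      ultimately show ?thesis
        by (rule nowhere_dense_in_subset)
    qed
    then have "meager_in Y {y. (x, y) \<in> N}"
      unfolding meager_in_def F(2) by (intro exI[of _ "\<lambda>i. {y. (x, y) \<in> F i}"]) auto
    then show False
      using x by simp
  qed
  then show ?thesis
    using meager meager_in_subset by blast
qed

lemma uncountable_UNIV_nat_bool: "\<not> countable (UNIV :: (nat \<Rightarrow> bool) set)"
proof
  assume "countable (UNIV :: (nat \<Rightarrow> bool) set)"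
  then have "range (from_nat_into UNIV) = (UNIV :: (nat \<Rightarrow> bool) set)"
    by (intro range_from_nat_into) auto
  then obtain k where "(\<lambda>n. \<not> (from_nat_into UNIV n :: nat \<Rightarrow> bool) n) = from_nat_into UNIV k"
    by (metis UNIV_I image_iff)
  then show False by (metis (no_types))
qed

lemma S_inf_mult: "bij f \<Longrightarrow> bij g \<Longrightarrow> f \<otimes>\<^bsub>S_inf\<^esub> g = f \<circ> g"
  by (simp add: S_inf_def BijGroup_def Bij_def compose_def fun_eq_iff)

lemma S_inf_carrier: "carrier S_inf = {f. bij f}"
  by (simp add: S_inf_def BijGroup_def Bij_def)

lemma S_inf_one: "\<one>\<^bsub>S_inf\<^esub> = id"
  by (simp add: S_inf_def BijGroup_def fun_eq_iff)

section \<open>Closed permutation groups\<close>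

text \<open>
  The closed subgroups of the group of all permutations of \<open>\<nat>\<close>, stated with composition and inverse of
  functions. The lemma \<open>closed_perm_group_of_subgroup\<close> makes the connection with
  \<^const>\<open>closed_subgroup_S_inf\<close>.
\<close>

locale closed_perm_group =
  fixes G :: "(nat \<Rightarrow> nat) set"
  assumes bij: "g \<in> G \<Longrightarrow> bij g"
    and id_mem: "id \<in> G"
    and comp_mem: "g \<in> G \<Longrightarrow> h \<in> G \<Longrightarrow> g \<circ> h \<in> G"
    and inv_mem: "g \<in> G \<Longrightarrow> inv g \<in> G"
    and closed: "closedin (top_of_set {f. bij f}) G"
begin

lemma inv_apply [simp]:
  assumes "g \<in> G"
  shows "inv g (g k) = k" "g (inv g k) = k"
  by (rule inv_f_f[OF bij_is_inj[OF bij[OF assms]]], rule surj_f_inv_f[OF bij_is_surj[OF bij[OF assms]]])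

lemma inv_comp: "g \<in> G \<Longrightarrow> h \<in> G \<Longrightarrow> inv (g \<circ> h) = inv h \<circ> inv g"
  by (rule o_inv_distrib[OF bij bij])

lemma inv_inv: "g \<in> G \<Longrightarrow> inv (inv g) = g"
  by (rule inv_inv_eq[OF bij])

text \<open>
  Completeness of \<open>G\<close> for two-sided pointwise convergence. Control of the inverses is essential: a
  pointwise limit of permutations is injective but can fail to be surjective.
\<close>

lemma limit_of_stabilizing:
  fixes P :: "nat \<Rightarrow> nat \<Rightarrow> nat"
  assumes P: "\<And>i. P i \<in> G"
    and step: "\<And>i k. k < i \<Longrightarrow> P (Suc i) k = P i k \<and> inv (P (Suc i)) k = inv (P i) k"
  shows "\<exists>p\<in>G. \<forall>i k. k < i \<longrightarrow> P i k = p k \<and> inv (P i) k = inv p k"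
proof -
  define p where "p k = P (Suc k) k" for k
  define q where "q k = inv (P (Suc k)) k" for k
  have pq: "P i k = p k" "inv (P i) k = q k" if "k < i" for i k
  proof -
    from that have "Suc k \<le> i" by simp
    then have "P i k = p k \<and> inv (P i) k = q k"
      by (induction i rule: dec_induct) (use step in \<open>auto simp: p_def q_def\<close>)
    then show "P i k = p k" "inv (P i) k = q k" by auto
  qed
  have "p (q k) = k" for k
  proof -
    define N where "N = Suc (max k (q k))"
    have "p (q k) = P N (inv (P N) k)"
      using pq[of k N] pq[of "q k" N] by (simp add: N_def)
    then show ?thesis using P by simp
  qed
  moreover have "q (p k) = k" for k
  proof -
    define N where "N = Suc (max k (p k))"
    have "q (p k) = inv (P N) (P N k)"
      using pq[of k N] pq[of "p k" N] by (simp add: N_def)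
    then show ?thesis using P by simp
  qed
  ultimately have pq_id: "q \<circ> p = id" "p \<circ> q = id"
    by (auto simp: fun_eq_iff)
  then have "bij p"
    by (rule o_bij)
  have q: "inv p = q"
    using pq_id(2,1) by (rule inv_unique_comp)
  obtain T where T: "closed T" "G = {f. bij f} \<inter> T"
    using closed by (auto simp: closedin_closed)
  have "(\<lambda>i. P i k) \<longlonglongrightarrow> p k" for k
    by (intro tendsto_eventually eventually_sequentiallyI[of "Suc k"]) (simp add: pq)
  then have "limitin (product_topology (\<lambda>_::nat. euclidean :: nat topology) UNIV) P p sequentially"
    by (simp add: limitin_componentwise)
  then have "P \<longlonglongrightarrow> p"
    by (simp add: euclidean_product_topology)
  have "P i \<in> T" for i
    using P T(2) by auto
  then have "p \<in> T"
    using \<open>P \<longlonglongrightarrow> p\<close> by (rule closed_sequentially[OF T(1)])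
  with \<open>bij p\<close> T have "p \<in> G" by simp
  then show ?thesis
    using pq q by (intro bexI[of _ p]) auto
qed

abbreviation T where "T \<equiv> top_of_set G"

abbreviation tuples :: "nat \<Rightarrow> (nat \<Rightarrow> nat \<Rightarrow> nat) topology" where
  "tuples n \<equiv> product_topology (\<lambda>_. T) {..<n}"

lemma euclidean_eq_discrete: "(euclidean :: nat topology) = discrete_topology UNIV"
  by (simp add: topology_eq open_discrete)

text \<open>The permutations form a \<open>G\<^sub>\<delta>\<close> subset of \<open>\<nat> \<Rightarrow> \<nat>\<close>, and \<open>G\<close> is closed in it.\<close>

lemma completely_metrizable_T: "completely_metrizable_space T"
proof -
  let ?X = "euclidean :: (nat \<Rightarrow> nat) topology"
  have "completely_metrizable_space (product_topology (\<lambda>_::nat. euclidean :: nat topology) UNIV)"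
    using completely_metrizable_space_product_topology[of "\<lambda>_::nat. euclidean :: nat topology" UNIV]
      completely_metrizable_space_discrete_topology[of "UNIV :: nat set"]
    by (simp add: euclidean_eq_discrete)
  then have X: "completely_metrizable_space ?X"
    by (simp add: euclidean_product_topology)
  have "openin ?X {f. f i = j}" for i j :: nat
  proof -
    have "open ((\<lambda>f::nat \<Rightarrow> nat. f i) -` {j})"
      by (intro open_vimage open_discrete continuous_on_product_coordinates)
    then show ?thesis by (simp add: vimage_def)
  qed note o1 = this
  have o2: "openin ?X {f. f i \<noteq> f j}" for i j :: nat
  proof -
    have "{f::nat \<Rightarrow> nat. f i \<noteq> f j} = (\<Union>k. \<Union>l\<in>-{k}. {f. f i = k} \<inter> {f. f j = l})" by auto
    moreover have "openin ?X (\<Union>k. \<Union>l\<in>-{k}. {f. f i = k} \<inter> {f. f j = l})"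
      using o1 by (intro openin_Union ballI) auto
    ultimately show ?thesis by simp
  qed
  have o3: "openin ?X {f. \<exists>i. f i = j}" for j :: nat
  proof -
    have "{f::nat \<Rightarrow> nat. \<exists>i. f i = j} = (\<Union>i. {f. f i = j})" by auto
    moreover have "openin ?X (\<Union>i. {f. f i = j})"
      using o1 by (intro openin_Union ballI) auto
    ultimately show ?thesis by simp
  qed
  have bij_eq: "{f::nat \<Rightarrow> nat. bij f} =
      \<Inter>((\<lambda>(i, j). if i = j then UNIV else {f. f i \<noteq> f j}) ` UNIV \<union> (\<lambda>j. {f. \<exists>i. f i = j}) ` UNIV)"
    (is "?L = \<Inter>(?A \<union> ?B)")
  proof -
    have "f \<in> \<Inter>?A \<longleftrightarrow> inj f" for f :: "nat \<Rightarrow> nat"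
      by (auto simp: inj_def)
    moreover have "f \<in> \<Inter>?B \<longleftrightarrow> surj f" for f :: "nat \<Rightarrow> nat"
    proof -
      have "f \<in> \<Inter>?B \<longleftrightarrow> (\<forall>j. \<exists>i. f i = j)" by simp
      then show ?thesis unfolding surj_def by metis
    qed
    ultimately show ?thesis
      unfolding Inter_Un_distrib set_eq_iff Int_iff mem_Collect_eq bij_def by simp
  qed
  have "gdelta_in ?X {f. bij f}"
    unfolding bij_eq
    by (rule gdelta_in_Inter) (use o2 o3 in \<open>auto intro!: open_imp_gdelta_in\<close>)
  then have "completely_metrizable_space (top_of_set {f::nat \<Rightarrow> nat. bij f})"
    using X completely_metrizable_space_gdelta_in by blast
  then have "completely_metrizable_space (subtopology (top_of_set {f. bij f}) G)"
    using closed completely_metrizable_space_closedin by blast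
  moreover have "subtopology (top_of_set {f. bij f}) G = T"
  proof -
    have "{f. bij f} \<inter> G = G"
      using bij by auto
    then show ?thesis
      by (simp add: subtopology_subtopology)
  qed
  ultimately show ?thesis by simp
qed

lemma completely_metrizable_tuples: "completely_metrizable_space (tuples n)"
  using completely_metrizable_T completely_metrizable_space_product_topology[of "\<lambda>_. T" "{..<n}"]
  by simp

lemma countable_base_T:
  "\<exists>\<B>. countable \<B> \<and> (\<forall>U\<in>\<B>. openin T U \<and> U \<noteq> {}) \<and> (\<forall>V. openin T V \<longrightarrow> V \<noteq> {} \<longrightarrow> (\<exists>U\<in>\<B>. U \<subseteq> V))"
proof -
  obtain B :: "(nat \<Rightarrow> nat) set set" where B: "countable B" "topological_basis B"
    using ex_countable_basis by blast
  let ?\<B> = "(\<lambda>b. G \<inter> b) ` B - {{}}"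
  have "\<exists>U\<in>?\<B>. U \<subseteq> V" if V: "openin T V" "V \<noteq> {}" for V
  proof -
    obtain W where W: "open W" "V = G \<inter> W"
      using V(1) by (auto simp: openin_open)
    obtain x where x: "x \<in> V" using V(2) by blast
    have "x \<in> G" "x \<in> W" using x W(2) by auto
    obtain b where b: "b \<in> B" "x \<in> b" "b \<subseteq> W"
      using topological_basisE[OF B(2) W(1) \<open>x \<in> W\<close>] by metis
    then have "G \<inter> b \<in> ?\<B>" using \<open>x \<in> G\<close> by auto
    moreover have "G \<inter> b \<subseteq> V" using b(3) W(2) by auto
    ultimately show ?thesis by (rule bexI[rotated])
  qed
  moreover have "openin T U" if "U \<in> ?\<B>" for U
    using that topological_basis_open[OF B(2)] by (auto simp: openin_open)
  ultimately show ?thesis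
    using B(1) by (intro exI[of _ ?\<B>]) auto
qed

text \<open>The pointwise stabilizers of initial segments: a neighbourhood base at the identity that consists
  of open subgroups.\<close>

definition stab :: "nat \<Rightarrow> (nat \<Rightarrow> nat) set" where
  "stab m = {g \<in> G. \<forall>k<m. g k = k}"

lemma stab_mono: "m \<le> n \<Longrightarrow> stab n \<subseteq> stab m"
  by (auto simp: stab_def)

lemma stab_subset: "stab m \<subseteq> G"
  by (auto simp: stab_def)

lemma id_stab: "id \<in> stab m"
  by (simp add: stab_def id_mem)

lemma inv_stab: "g \<in> stab m \<Longrightarrow> inv g \<in> stab m"
proof -
  assume g: "g \<in> stab m"
  then have "inv g k = k" if "k < m" for k
    using that inv_apply(1)[of g k] by (simp add: stab_def)
  with g show ?thesis
    by (simp add: stab_def inv_mem)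
qed

lemma comp_stab: "g \<in> stab m \<Longrightarrow> h \<in> stab m \<Longrightarrow> g \<circ> h \<in> stab m"
  using comp_mem by (auto simp: stab_def)

lemma openin_T_agree: "openin T {f \<in> G. \<forall>k<m. f k = g k}"
proof -
  have "open ((\<lambda>f::nat \<Rightarrow> nat. f k) -` {g k})" for k
    by (intro open_vimage open_discrete continuous_on_product_coordinates)
  then have "open (\<Inter>k<m. (\<lambda>f::nat \<Rightarrow> nat. f k) -` {g k})"
    by (intro open_INT) auto
  moreover have "{f \<in> G. \<forall>k<m. f k = g k} = G \<inter> (\<Inter>k<m. (\<lambda>f::nat \<Rightarrow> nat. f k) -` {g k})"
    by auto
  ultimately show ?thesis by (simp only: openin_open_Int)
qed

lemma openin_T_imp_agree:
  assumes "openin T U" "g \<in> U"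
  shows "\<exists>m. {f \<in> G. \<forall>k<m. f k = g k} \<subseteq> U"
proof -
  obtain W where W: "open W" "U = G \<inter> W"
    using assms(1) by (auto simp: openin_open)
  then have "openin (product_topology (\<lambda>_::nat. euclidean :: nat topology) UNIV) W"
    by (simp add: euclidean_product_topology)
  moreover have "g \<in> W"
    using assms(2) W(2) by simp
  ultimately obtain V :: "nat \<Rightarrow> nat set"
    where V: "finite {i. V i \<noteq> UNIV}" "g \<in> Pi\<^sub>E UNIV V" "Pi\<^sub>E UNIV V \<subseteq> W"
    unfolding openin_product_topology_alt by auto
  obtain m where m: "\<forall>i\<in>{i. V i \<noteq> UNIV}. i < m"
    using V(1) finite_nat_set_iff_bounded by blast
  have "f \<in> W" if "\<forall>k<m. f k = g k" for f
  proof -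
    have "f i \<in> V i" for i
      using m that V(2) by (cases "i < m") (auto simp: PiE_iff)
    then show ?thesis using V(3) by auto
  qed
  then show ?thesis using W(2) by blast
qed

lemma openin_tuples_agree:
  assumes "y \<in> topspace (tuples n)"
  shows "openin (tuples n) {z \<in> topspace (tuples n). \<forall>j<n. \<forall>k<i. z j k = y j k}"
proof -
  have "openin (tuples n) (Pi\<^sub>E {..<n} (\<lambda>j. {f \<in> G. \<forall>k<i. f k = y j k}))"
    using openin_T_agree by (simp add: openin_PiE_gen)
  moreover have "Pi\<^sub>E {..<n} (\<lambda>j. {f \<in> G. \<forall>k<i. f k = y j k}) =
      {z \<in> topspace (tuples n). \<forall>j<n. \<forall>k<i. z j k = y j k}"
    by (auto simp: PiE_iff extensional_def)
  ultimately show ?thesis by simp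
qed

lemma continuous_translation: "continuous_on S (\<lambda>f. g \<circ> f \<circ> h)" for S :: "(nat \<Rightarrow> nat) set" and g h :: "nat \<Rightarrow> nat"
proof (rule continuous_on_coordinatewise_then_product)
  fix k
  have g: "continuous_on UNIV g" by (simp add: continuous_on_open_vimage open_discrete)
  have "continuous_on S (\<lambda>f::nat \<Rightarrow> nat. f (h k))"
    by (rule continuous_on_subset[OF continuous_on_product_coordinates subset_UNIV])
  then have "continuous_on S (\<lambda>f. g (f (h k)))"
    by (rule continuous_on_compose2[OF g]) simp
  then show "continuous_on S (\<lambda>f. (g \<circ> f \<circ> h) k)" by simp
qed

lemma homeomorphic_translation:
  assumes "g \<in> G" "h \<in> G"
  shows "homeomorphic_map T T (\<lambda>f. g \<circ> f \<circ> h)"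
proof (rule homeomorphic_maps_imp_map)
  have "continuous_map T T (\<lambda>f. g \<circ> f \<circ> h)" if "g \<in> G" "h \<in> G" for g h
    using that comp_mem continuous_translation by (intro continuous_map_into_subtopology) auto
  then show "homeomorphic_maps T T (\<lambda>f. g \<circ> f \<circ> h) (\<lambda>f. inv g \<circ> f \<circ> inv h)"
    using assms inv_mem by (simp add: homeomorphic_maps_def fun_eq_iff)
qed

section \<open>Conjugation of tuples and the theorem of Effros\<close>

definition conj_tuple :: "nat \<Rightarrow> (nat \<Rightarrow> nat) \<Rightarrow> (nat \<Rightarrow> nat \<Rightarrow> nat) \<Rightarrow> nat \<Rightarrow> nat \<Rightarrow> nat" where
  "conj_tuple n g x = (\<lambda>j\<in>{..<n}. g \<circ> x j \<circ> inv g)"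

definition conj_orbit :: "nat \<Rightarrow> (nat \<Rightarrow> nat \<Rightarrow> nat) \<Rightarrow> (nat \<Rightarrow> nat \<Rightarrow> nat) set" where
  "conj_orbit n x = (\<lambda>g. conj_tuple n g x) ` G"

lemma conj_tuple_apply: "j < n \<Longrightarrow> conj_tuple n g x j = g \<circ> x j \<circ> inv g"
  by (simp add: conj_tuple_def)

lemma conj_tuple_mem:
  assumes "g \<in> G" "x \<in> topspace (tuples n)"
  shows "conj_tuple n g x \<in> topspace (tuples n)"
  using assms comp_mem inv_mem by (auto simp: conj_tuple_def PiE_iff)

lemma conj_tuple_comp:
  assumes "g \<in> G" "h \<in> G"
  shows "conj_tuple n g (conj_tuple n h x) = conj_tuple n (g \<circ> h) x"
  by (simp add: conj_tuple_def inv_comp[OF assms] fun_eq_iff restrict_def)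

lemma conj_tuple_id:
  assumes "x \<in> topspace (tuples n)"
  shows "conj_tuple n id x = x"
proof
  fix j show "conj_tuple n id x j = x j"
    using assms by (cases "j < n") (auto simp: conj_tuple_def PiE_iff extensional_def)
qed

lemma conj_tuple_inv:
  assumes "g \<in> G" "x \<in> topspace (tuples n)"
  shows "conj_tuple n (inv g) (conj_tuple n g x) = x"
    and "conj_tuple n g (conj_tuple n (inv g) x) = x"
proof -
  have "inv g \<circ> g = id" "g \<circ> inv g = id"
    using assms(1) by (auto simp: fun_eq_iff)
  then show "conj_tuple n (inv g) (conj_tuple n g x) = x"
    "conj_tuple n g (conj_tuple n (inv g) x) = x"
    by (simp_all only: conj_tuple_comp[OF inv_mem[OF assms(1)] assms(1)]
        conj_tuple_comp[OF assms(1) inv_mem[OF assms(1)]] conj_tuple_id[OF assms(2)])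
qed

lemma homeomorphic_conj_tuple:
  assumes "g \<in> G"
  shows "homeomorphic_map (tuples n) (tuples n) (conj_tuple n g)"
proof (rule homeomorphic_maps_imp_map)
  have "continuous_map (tuples n) (tuples n) (conj_tuple n g)" if g: "g \<in> G" for g
    unfolding continuous_map_componentwise
  proof (intro conjI ballI)
    show "conj_tuple n g ` topspace (tuples n) \<subseteq> extensional {..<n}"
      by (auto simp: conj_tuple_def)
    fix j assume j: "j \<in> {..<n}"
    have "continuous_map (tuples n) T ((\<lambda>f. g \<circ> f \<circ> inv g) \<circ> (\<lambda>x. x j))"
      using continuous_map_product_projection[OF j]
        homeomorphic_imp_continuous_map[OF homeomorphic_translation[OF g inv_mem[OF g]]]
      by (rule continuous_map_compose)
    then show "continuous_map (tuples n) T (\<lambda>x. conj_tuple n g x j)"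
      using j by (simp add: o_def conj_tuple_def)
  qed
  then show "homeomorphic_maps (tuples n) (tuples n) (conj_tuple n g) (conj_tuple n (inv g))"
    using assms inv_mem conj_tuple_inv unfolding homeomorphic_maps_def by simp
qed

lemma conj_orbit_subset:
  "x \<in> topspace (tuples n) \<Longrightarrow> conj_orbit n x \<subseteq> topspace (tuples n)"
  unfolding conj_orbit_def using conj_tuple_mem by blast

lemma conj_orbit_eq:
  assumes "y \<in> conj_orbit n x" "x \<in> topspace (tuples n)"
  shows "conj_orbit n y = conj_orbit n x"
proof -
  obtain h where h: "h \<in> G" "y = conj_tuple n h x"
    using assms(1) by (auto simp: conj_orbit_def)
  have "conj_tuple n g y = conj_tuple n (g \<circ> h) x" if "g \<in> G" for g
    using that h conj_tuple_comp by simp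
  moreover have "conj_tuple n g x = conj_tuple n (g \<circ> inv h) y" if g: "g \<in> G" for g
    using conj_tuple_comp[OF g inv_mem[OF h(1)]] conj_tuple_inv(1)[OF h(1) assms(2)] h(2) by metis
  ultimately show ?thesis
    unfolding conj_orbit_def using h(1) comp_mem inv_mem by (auto; blast)
qed

text \<open>
  Countably many translates of the orbit of \<open>x\<close> under \<open>stab m\<close> cover the whole orbit, one for
  each restriction of an element of \<open>G\<close> to \<open>{..<m}\<close>. So the small orbit is somewhere dense, and since its
  elements are moved to \<open>x\<close> by homeomorphisms that preserve it, it is dense near \<open>x\<close>.
\<close>

lemma interior_closure_stab_orbit:
  assumes x: "x \<in> topspace (tuples n)" and nm: "\<not> meager_in (tuples n) (conj_orbit n x)"
  shows "x \<in> tuples n interior_of (tuples n closure_of ((\<lambda>g. conj_tuple n g x) ` stab m))"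
proof -
  define S where "S = (\<lambda>g. conj_tuple n g x) ` stab m"
  have S_sub: "S \<subseteq> topspace (tuples n)"
    using conj_tuple_mem x stab_subset unfolding S_def by blast
  \<comment> \<open>The part of the orbit that comes from the coset of permutations with initial values \<open>s\<close>.\<close>
  define A where "A s = (\<lambda>g. conj_tuple n g x) ` {g \<in> G. map g [0..<m] = s}" for s
  have "conj_orbit n x = \<Union>(range A)"
    by (auto simp: conj_orbit_def A_def)
  then obtain s where s: "\<not> meager_in (tuples n) (A s)"
    using nm meager_in_Union[of "range A" "tuples n"] by auto
  have "A s \<noteq> {}"
    using s meager_in_Union[of "{}" "tuples n"] by auto
  then obtain g0 where g0: "g0 \<in> G" "map g0 [0..<m] = s"
    by (auto simp: A_def)
  have "A s \<subseteq> conj_tuple n g0 ` S"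
  proof
    fix z assume "z \<in> A s"
    then obtain g where g: "g \<in> G" "map g [0..<m] = s" "z = conj_tuple n g x"
      by (auto simp: A_def)
    have "g k = g0 k" if "k < m" for k
      using g(2) g0(2) that by (metis add_0 diff_zero length_upt nth_map nth_upt)
    then have "inv g0 \<circ> g \<in> stab m"
      using g g0 comp_mem inv_mem by (simp add: stab_def)
    moreover have "g0 \<circ> (inv g0 \<circ> g) = g"
      using g0(1) by (simp add: fun_eq_iff)
    then have "z = conj_tuple n g0 (conj_tuple n (inv g0 \<circ> g) x)"
      using g g0 comp_mem inv_mem conj_tuple_comp by simp
    ultimately show "z \<in> conj_tuple n g0 ` S"
      by (auto simp: S_def)
  qed
  then have "\<not> meager_in (tuples n) S"
    using s meager_in_subset meager_in_homeomorphic_image[OF homeomorphic_conj_tuple[OF g0(1)]] by blast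
  then have "\<not> nowhere_dense_in (tuples n) S"
    unfolding meager_in_def by (metis UN_constant UNIV_not_empty)
  then have "tuples n interior_of (tuples n closure_of S) \<noteq> {}"
    using S_sub by (simp add: nowhere_dense_in_def)
  moreover have "tuples n interior_of (tuples n closure_of S) \<subseteq> tuples n closure_of S"
    by (rule interior_of_subset)
  ultimately have "tuples n interior_of (tuples n closure_of S) \<inter> S \<noteq> {}"
    using openin_Int_closure_of_eq_empty[OF openin_interior_of, of "tuples n" "tuples n closure_of S" S] by blast
  then obtain h where h: "h \<in> stab m" "conj_tuple n h x \<in> tuples n interior_of (tuples n closure_of S)"
    by (auto simp: S_def)
  have hG: "h \<in> G" "inv h \<in> G" using h(1) stab_subset inv_mem by auto
  have inv_S: "conj_tuple n (inv h) ` S \<subseteq> S"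
  proof
    fix z assume "z \<in> conj_tuple n (inv h) ` S"
    then obtain g where g: "g \<in> stab m" "z = conj_tuple n (inv h) (conj_tuple n g x)"
      by (auto simp: S_def)
    then have "z = conj_tuple n (inv h \<circ> g) x"
      using conj_tuple_comp[OF hG(2)] subsetD[OF stab_subset g(1)] by simp
    then show "z \<in> S"
      using comp_stab[OF inv_stab[OF h(1)] g(1)] by (auto simp: S_def)
  qed
  have "x \<in> conj_tuple n (inv h) ` (tuples n interior_of (tuples n closure_of S))"
    using imageI[OF h(2), of "conj_tuple n (inv h)"] by (simp only: conj_tuple_inv(1)[OF hG(1) x])
  also have "\<dots> = tuples n interior_of (tuples n closure_of (conj_tuple n (inv h) ` S))"
    by (simp only: homeomorphic_map_closure_of[OF homeomorphic_conj_tuple[OF hG(2)] S_sub]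
      homeomorphic_map_interior_of[OF homeomorphic_conj_tuple[OF hG(2)] closure_of_subset_topspace])
  also have "\<dots> \<subseteq> tuples n interior_of (tuples n closure_of S)"
    using inv_S by (intro interior_of_mono closure_of_mono)
  finally show ?thesis by (simp add: S_def)
qed

lemma stab_comp_agree:
  assumes "g \<in> stab N" "P \<in> G" "i \<le> N" "\<And>k. k < i \<Longrightarrow> P k < N" "k < i"
  shows "(g \<circ> P) k = P k" "inv (g \<circ> P) k = inv P k"
proof -
  have g: "g \<in> G" using assms(1) stab_subset by auto
  show "(g \<circ> P) k = P k"
    using assms(1,4,5) by (simp add: stab_def)
  have "inv g k = k"
    using inv_stab[OF assms(1)] assms(3,5) by (simp add: stab_def)
  then show "inv (g \<circ> P) k = inv P k"
    using inv_comp[OF g assms(2)] by simp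
qed

lemma conj_tuple_limit:
  assumes p: "\<And>i k. k < i \<Longrightarrow> P i k = p k \<and> inv (P i) k = inv p k" and "j < n"
  shows "eventually (\<lambda>i. conj_tuple n (P i) x j k = conj_tuple n p x j k) sequentially"
  using eventually_gt_at_top[of k] eventually_gt_at_top[of "x j (inv p k)"]
  by eventually_elim (use assms in \<open>simp add: conj_tuple_def\<close>)

text \<open>
  Back and forth. If \<open>y\<close> in the orbit of \<open>x\<close> is close to \<open>x\<close>, it is in the interior of the closure
  of the orbit of \<open>x\<close> under \<open>stab m\<close>. An element of \<open>stab m\<close> then moves \<open>x\<close> so close to \<open>y\<close> that
  in turn an element of a smaller stabilizer moves \<open>y\<close> still closer to the new \<open>x\<close>, and so on. The
  moves get small fast enough for their products \<open>P i\<close> and \<open>Q i\<close> to converge to \<open>p\<close> and \<open>q\<close> in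
  \<open>stab m\<close>, and in the limit \<open>p\<close> takes \<open>x\<close> where \<open>q\<close> takes \<open>y\<close>.
\<close>

lemma Effros_conj_orbit:
  assumes x: "x \<in> topspace (tuples n)" and nm: "\<not> meager_in (tuples n) (conj_orbit n x)"
  shows "\<exists>U. openin (tuples n) U \<and> x \<in> U \<and>
    (\<forall>y\<in>U \<inter> conj_orbit n x. \<exists>g\<in>stab m. y = conj_tuple n g x)"
proof -
  define I where "I m z = tuples n interior_of (tuples n closure_of ((\<lambda>g. conj_tuple n g z) ` stab m))" for m z
  have I_open: "openin (tuples n) (I m z)" for m z
    by (simp add: I_def)
  have I_self: "z \<in> I m z" if "z \<in> conj_orbit n x" for m z
    unfolding I_def using interior_closure_stab_orbit conj_orbit_eq[OF that x] that nm conj_orbit_subset[OF x]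
    by auto
  have I_approx: "\<exists>g\<in>stab m. conj_tuple n g z \<in> W" if "v \<in> I m z" "openin (tuples n) W" "v \<in> W" for m z v W
  proof -
    have "v \<in> tuples n closure_of ((\<lambda>g. conj_tuple n g z) ` stab m)"
      using that(1) subsetD[OF interior_of_subset] unfolding I_def by metis
    then show ?thesis
      using that(2,3) unfolding in_closure_of by auto
  qed
  have orbit_conj: "conj_tuple n g z \<in> conj_orbit n x" if "z \<in> conj_orbit n x" "g \<in> G" for g z
  proof -
    have "conj_tuple n g z \<in> conj_orbit n z" using that(2) by (simp add: conj_orbit_def)
    then show ?thesis using conj_orbit_eq[OF that(1) x] by simp
  qed
  have x_orbit: "x \<in> conj_orbit n x"
    unfolding conj_orbit_def using conj_tuple_id[OF x] id_mem by (metis image_eqI)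
  \<comment> \<open>Large enough that multiplying \<open>P\<close> on the left by an element of \<open>stab (M i P)\<close> keeps the first
    \<open>i\<close> values of \<open>P\<close> and of its inverse.\<close>
  define M where "M i P = m + i + (\<Sum>k<i. Suc (P k))" for i and P :: "nat \<Rightarrow> nat"
  have M_gt: "P k < M i P" if "k < i" for P k i
    using member_le_sum[of k "{..<i}" "\<lambda>k. Suc (P k)"] that by (simp add: M_def)
  have M_ge: "m \<le> M i P" "i \<le> M i P" for i P
    by (auto simp: M_def)
  have "\<exists>g\<in>stab m. y = conj_tuple n g x" if "y \<in> I m x" "y \<in> conj_orbit n x" for y
  proof -
    have y: "y \<in> topspace (tuples n)"
      using that(2) conj_orbit_subset[OF x] by auto
    \<comment> \<open>Each step makes one move of \<open>x\<close> and one of \<open>y\<close>; the invariant says that \<open>x\<close> can move next.\<close>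
    define Inv where "Inv = (\<lambda>i (P, Q). P \<in> stab m \<and> Q \<in> stab m \<and> conj_tuple n Q y \<in> I (M i P) (conj_tuple n P x))"
    define Step where "Step = (\<lambda>i (P, Q) (P', Q').
        (\<forall>k<i. P' k = P k \<and> inv P' k = inv P k) \<and> (\<forall>k<i. Q' k = Q k \<and> inv Q' k = inv Q k) \<and>
        (\<forall>j<n. \<forall>k<i. conj_tuple n P' x j k = conj_tuple n Q y j k))"
    have step: "\<exists>s'. Inv (Suc i) s' \<and> Step i s s'" if inv: "Inv i s" for i s
    proof -
      obtain P Q where s: "s = (P, Q)" by force
      have PQ: "P \<in> stab m" "Q \<in> stab m" "P \<in> G" "Q \<in> G"
        and close: "conj_tuple n Q y \<in> I (M i P) (conj_tuple n P x)"
        using inv stab_subset by (auto simp: s Inv_def)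
      let ?u = "conj_tuple n P x" and ?v = "conj_tuple n Q y"
      have uv: "?u \<in> conj_orbit n x" "?v \<in> conj_orbit n x"
        using orbit_conj x_orbit \<open>y \<in> conj_orbit n x\<close> PQ by auto
      have v: "?v \<in> topspace (tuples n)" using conj_tuple_mem PQ y by blast
      let ?B = "{z \<in> topspace (tuples n). \<forall>j<n. \<forall>k<i. z j k = ?v j k}"
      have "openin (tuples n) (I (M i Q) ?v \<inter> ?B)"
        using I_open openin_tuples_agree[OF v] by (rule openin_Int)
      moreover have "?v \<in> I (M i Q) ?v \<inter> ?B"
        using I_self[OF uv(2)] v by simp
      ultimately obtain g where g: "g \<in> stab (M i P)" "conj_tuple n g ?u \<in> I (M i Q) ?v \<inter> ?B"
        using I_approx[OF close, of "I (M i Q) ?v \<inter> ?B"] by auto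
      have gG: "g \<in> stab m" "g \<in> G" using subsetD[OF stab_mono[OF M_ge(1)] g(1)] subsetD[OF stab_subset g(1)] by auto
      define P' where "P' = g \<circ> P"
      have P': "P' \<in> stab m" "P' \<in> G" using comp_stab[OF gG(1) PQ(1)] comp_mem[OF gG(2) PQ(3)] by (auto simp: P'_def)
      have u': "conj_tuple n P' x = conj_tuple n g ?u"
        using conj_tuple_comp[OF gG(2) PQ(3)] by (simp add: P'_def)
      have near: "conj_tuple n P' x \<in> I (M i Q) ?v"
        using g(2) u' by simp
      have "conj_tuple n P' x \<in> I (M (Suc i) P') (conj_tuple n P' x)"
        using I_self[OF orbit_conj[OF x_orbit P'(2)]] .
      then obtain h where h: "h \<in> stab (M i Q)" "conj_tuple n h ?v \<in> I (M (Suc i) P') (conj_tuple n P' x)"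
        using I_approx[OF near I_open] by auto
      have hG: "h \<in> stab m" "h \<in> G" using subsetD[OF stab_mono[OF M_ge(1)] h(1)] subsetD[OF stab_subset h(1)] by auto
      define Q' where "Q' = h \<circ> Q"
      have Q': "Q' \<in> stab m" using comp_stab[OF hG(1) PQ(2)] by (simp add: Q'_def)
      have v': "conj_tuple n Q' y = conj_tuple n h ?v"
        using conj_tuple_comp[OF hG(2) PQ(4)] by (simp add: Q'_def)
      have "Inv (Suc i) (P', Q')"
        using P' Q' h(2) v' by (simp add: Inv_def)
      moreover have "\<forall>k<i. P' k = P k \<and> inv P' k = inv P k"
        using stab_comp_agree[OF g(1) PQ(3) M_ge(2) M_gt] by (simp add: P'_def)
      moreover have "\<forall>k<i. Q' k = Q k \<and> inv Q' k = inv Q k"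
        using stab_comp_agree[OF h(1) PQ(4) M_ge(2) M_gt] by (simp add: Q'_def)
      moreover have "\<forall>j<n. \<forall>k<i. conj_tuple n P' x j k = ?v j k"
        using g(2) u' by simp
      ultimately show ?thesis
        unfolding s Step_def by (intro exI[of _ "(P', Q')"]) simp
    qed
    have "Inv 0 (id, id)"
      using \<open>y \<in> I m x\<close> by (simp add: Inv_def id_stab conj_tuple_id[OF x] conj_tuple_id[OF y] M_def)
    then obtain s where s: "\<And>i. Inv i (s i)" "\<And>i. Step i (s i) (s (Suc i))"
      using dependent_nat_choice[of Inv Step] step by metis
    define P where "P i = fst (s i)" for i
    define Q where "Q i = snd (s i)" for i
    have s_eq: "s i = (P i, Q i)" for i by (simp add: P_def Q_def)
    have PQ: "P i \<in> stab m" "Q i \<in> stab m" for i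
      using s(1)[of i] by (auto simp: s_eq Inv_def)
    have Pstep: "P (Suc i) k = P i k \<and> inv (P (Suc i)) k = inv (P i) k" if "k < i" for i k
      using s(2)[of i] that by (auto simp: s_eq Step_def)
    have Qstep: "Q (Suc i) k = Q i k \<and> inv (Q (Suc i)) k = inv (Q i) k" if "k < i" for i k
      using s(2)[of i] that by (auto simp: s_eq Step_def)
    have cross: "conj_tuple n (P (Suc i)) x j k = conj_tuple n (Q i) y j k" if "j < n" "k < i" for i j k
      using s(2)[of i] that by (auto simp: s_eq Step_def)
    have PG: "P i \<in> G" "Q i \<in> G" for i using PQ stab_subset by auto
    obtain p where p: "p \<in> G" "\<And>i k. k < i \<Longrightarrow> P i k = p k \<and> inv (P i) k = inv p k"
      using limit_of_stabilizing[of P, OF PG(1) Pstep] by blast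
    obtain q where q: "q \<in> G" "\<And>i k. k < i \<Longrightarrow> Q i k = q k \<and> inv (Q i) k = inv q k"
      using limit_of_stabilizing[of Q, OF PG(2) Qstep] by blast
    have "p k = k \<and> q k = k" if "k < m" for k
      using p(2)[of k "Suc k"] q(2)[of k "Suc k"] PQ[of "Suc k"] that by (auto simp: stab_def)
    then have p_stab: "p \<in> stab m" and q_stab: "q \<in> stab m"
      using p(1) q(1) by (auto simp: stab_def)
    have "conj_tuple n p x = conj_tuple n q y"
    proof (intro ext)
      fix j k
      show "conj_tuple n p x j k = conj_tuple n q y j k"
      proof (cases "j < n")
        case True
        have "eventually (\<lambda>i. conj_tuple n (P (Suc i)) x j k = conj_tuple n p x j k) sequentially"
          using conj_tuple_limit[OF p(2) True] by (subst eventually_sequentially_Suc)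
        moreover have "eventually (\<lambda>i. conj_tuple n (Q i) y j k = conj_tuple n q y j k) sequentially"
          using conj_tuple_limit[OF q(2) True] .
        moreover have "eventually (\<lambda>i. k < i) sequentially"
          by (rule eventually_gt_at_top)
        ultimately have "eventually (\<lambda>i::nat. conj_tuple n p x j k = conj_tuple n q y j k) sequentially"
          by eventually_elim (use cross True in simp)
        then show ?thesis by simp
      qed (simp add: conj_tuple_def)
    qed
    then have "conj_tuple n (inv q) (conj_tuple n p x) = y"
      using conj_tuple_inv(1)[OF q(1) y] by simp
    then have "y = conj_tuple n (inv q \<circ> p) x"
      using conj_tuple_comp[OF inv_mem[OF q(1)] p(1)] by simp
    then show ?thesis
      using comp_stab[OF inv_stab[OF q_stab] p_stab] by blast
  qed
  then show ?thesis
    using I_open I_self[OF x_orbit] by (intro exI[of _ "I m x"]) auto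
qed

section \<open>Extending generic tuples\<close>

definition generic :: "nat \<Rightarrow> (nat \<Rightarrow> nat \<Rightarrow> nat) \<Rightarrow> bool" where
  "generic n x \<longleftrightarrow> x \<in> topspace (tuples n) \<and> comeager_in (tuples n) (conj_orbit n x)"

lemma topspace_not_meager: "\<not> meager_in (tuples n) (topspace (tuples n))"
proof -
  have "(\<lambda>j\<in>{..<n}. id) \<in> topspace (tuples n)"
    using id_mem by (simp add: PiE_iff)
  then show ?thesis
    by (intro not_meager_in_openin[OF completely_metrizable_tuples openin_topspace]) blast
qed

lemma comeager_meets_comeager:
  assumes "meager_in (tuples n) (topspace (tuples n) - S)" "meager_in (tuples n) (topspace (tuples n) - S')"
  shows "\<exists>z\<in>topspace (tuples n). z \<in> S \<and> z \<in> S'"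
proof (rule ccontr)
  assume "\<not> ?thesis"
  then have "topspace (tuples n) \<subseteq> (topspace (tuples n) - S) \<union> (topspace (tuples n) - S')"
    by blast
  then show False
    using meager_in_subset[OF meager_in_Un[OF assms]] topspace_not_meager by metis
qed

lemma generic_not_meager: "generic n x \<Longrightarrow> \<not> meager_in (tuples n) (conj_orbit n x)"
proof
  assume g: "generic n x" and m: "meager_in (tuples n) (conj_orbit n x)"
  have "meager_in (tuples n) (topspace (tuples n) - (topspace (tuples n) - conj_orbit n x))"
    by (rule meager_in_subset[OF m]) blast
  moreover have "meager_in (tuples n) (topspace (tuples n) - conj_orbit n x)"
    using g by (simp add: generic_def comeager_in_def)
  ultimately show False
    using comeager_meets_comeager by blast
qed

lemma generic_conj_tuple:
  assumes "generic n x" "g \<in> G"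
  shows "generic n (conj_tuple n g x)"
proof -
  have x: "x \<in> topspace (tuples n)" using assms(1) by (simp add: generic_def)
  have "conj_tuple n g x \<in> conj_orbit n x" using assms(2) by (simp add: conj_orbit_def)
  then show ?thesis
    using assms conj_orbit_eq[OF _ x] conj_tuple_mem[OF assms(2) x] by (simp add: generic_def)
qed

lemma generic_same_orbit:
  assumes x: "generic n x" and y: "generic n y"
  shows "y \<in> conj_orbit n x"
proof -
  have xy: "x \<in> topspace (tuples n)" "y \<in> topspace (tuples n)"
    using x y by (auto simp: generic_def)
  obtain z where z: "z \<in> conj_orbit n x" "z \<in> conj_orbit n y"
    using comeager_meets_comeager[of n "conj_orbit n x" "conj_orbit n y"] x y
    by (auto simp: generic_def comeager_in_def)
  have "y \<in> conj_orbit n y"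
    unfolding conj_orbit_def using conj_tuple_id[OF xy(2)] id_mem by (metis image_eqI)
  then show ?thesis
    using conj_orbit_eq[OF z(1) xy(1)] conj_orbit_eq[OF z(2) xy(2)] by simp
qed

lemma restrict_append:
  assumes "x \<in> topspace (tuples n)"
  shows "restrict (x(n := y)) {..<n} = x"
proof
  fix j show "restrict (x(n := y)) {..<n} j = x j"
    using assms by (cases "j < n") (simp_all add: PiE_iff extensional_def)
qed

lemma append_restrict:
  assumes "z \<in> topspace (tuples (Suc n))"
  shows "(restrict z {..<n})(n := z n) = z"
proof
  fix j show "((restrict z {..<n})(n := z n)) j = z j"
    using assms by (cases "j < n"; cases "j = n") (simp_all add: PiE_iff extensional_def)
qed

lemma homeomorphic_append:
  "homeomorphic_maps (prod_topology (tuples n) T) (tuples (Suc n))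
     (\<lambda>(x, y). x(n := y)) (\<lambda>z. (restrict z {..<n}, z n))"
  unfolding homeomorphic_maps_def
proof (intro conjI ballI)
  show "continuous_map (prod_topology (tuples n) T) (tuples (Suc n)) (\<lambda>(x, y). x(n := y))"
    unfolding continuous_map_componentwise
  proof (intro conjI ballI)
    show "(\<lambda>(x, y). x(n := y)) ` topspace (prod_topology (tuples n) T) \<subseteq> extensional {..<Suc n}"
      by (auto simp: PiE_iff extensional_def)
    fix k assume "k \<in> {..<Suc n}"
    then consider "k = n" | "k \<in> {..<n}" by fastforce
    then show "continuous_map (prod_topology (tuples n) T) T (\<lambda>p. (case p of (x, y) \<Rightarrow> x(n := y)) k)"
    proof cases
      case 1
      then show ?thesis
        using continuous_map_snd[of "tuples n" T] by (simp add: case_prod_unfold)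
    next
      case 2
      have "continuous_map (prod_topology (tuples n) T) T ((\<lambda>x. x k) \<circ> fst)"
        using continuous_map_fst continuous_map_product_projection[OF 2] by (rule continuous_map_compose)
      then show ?thesis
        using 2 by (simp add: case_prod_unfold o_def)
    qed
  qed
  have "continuous_map (tuples (Suc n)) (tuples n) (\<lambda>z. restrict z {..<n})"
    unfolding continuous_map_componentwise
    by (auto intro!: continuous_map_product_projection)
  then show "continuous_map (tuples (Suc n)) (prod_topology (tuples n) T) (\<lambda>z. (restrict z {..<n}, z n))"
    by (intro continuous_map_pairedI continuous_map_product_projection) auto
next
  fix p assume "p \<in> topspace (prod_topology (tuples n) T)"
  then have "fst p \<in> topspace (tuples n)"
    unfolding topspace_prod_topology by (rule mem_Times_iff[THEN iffD1, THEN conjunct1])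
  then show "(restrict ((\<lambda>(x, y). x(n := y)) p) {..<n}, (\<lambda>(x, y). x(n := y)) p n) = p"
    using restrict_append[of "fst p" n "snd p"] by (simp add: case_prod_unfold)
next
  fix z assume "z \<in> topspace (tuples (Suc n))"
  then show "(\<lambda>(x, y). x(n := y)) (restrict z {..<n}, z n) = z"
    using append_restrict by simp
qed

lemma append_mem:
  assumes "x \<in> topspace (tuples n)" "y \<in> G"
  shows "x(n := y) \<in> topspace (tuples (Suc n))"
  using assms by (simp add: PiE_iff extensional_def lessThan_Suc)

lemma continuous_append:
  assumes "x \<in> topspace (tuples n)"
  shows "continuous_map T (tuples (Suc n)) (\<lambda>y. x(n := y))"
proof -
  have "continuous_map T (prod_topology (tuples n) T) (\<lambda>y. (x, y))"
    using assms by (intro continuous_map_pairedI) auto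
  moreover have "continuous_map (prod_topology (tuples n) T) (tuples (Suc n)) (\<lambda>(x, y). x(n := y))"
    using homeomorphic_append by (simp add: homeomorphic_maps_def)
  ultimately have "continuous_map T (tuples (Suc n)) ((\<lambda>(x, y). x(n := y)) \<circ> (\<lambda>y. (x, y)))"
    by (rule continuous_map_compose)
  then show ?thesis
    by (simp add: o_def)
qed

lemma conj_tuple_append:
  "conj_tuple (Suc n) g (x(n := y)) = (conj_tuple n g x)(n := g \<circ> y \<circ> inv g)"
proof
  fix j show "conj_tuple (Suc n) g (x(n := y)) j = ((conj_tuple n g x)(n := g \<circ> y \<circ> inv g)) j"
    by (cases "j < n"; cases "j = n") (simp_all add: conj_tuple_def)
qed

text \<open>
  The theorem of Kuratowski and Ulam, applied to the comeager orbit of \<open>c\<close>, gives the claim for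
  comeagerly many tuples, hence for some conjugate \<open>w\<close> of \<open>x\<close>; conjugating back gives it for \<open>x\<close>.
\<close>

lemma generic_append_comeager:
  assumes x: "generic n x" and c: "generic (Suc n) c"
  shows "meager_in T (G - {y. generic (Suc n) (x(n := y))})"
proof -
  let ?C = "conj_orbit (Suc n) c"
  let ?\<psi> = "\<lambda>z. (restrict z {..<n}, z n) :: (nat \<Rightarrow> nat \<Rightarrow> nat) \<times> (nat \<Rightarrow> nat)"
  have xt: "x \<in> topspace (tuples n)" and ct: "c \<in> topspace (tuples (Suc n))"
    using x c by (auto simp: generic_def)
  have hom: "homeomorphic_map (tuples (Suc n)) (prod_topology (tuples n) T) ?\<psi>"
    using homeomorphic_append[of n, unfolded homeomorphic_maps_sym[of "prod_topology _ _"]]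
    by (rule homeomorphic_maps_imp_map)
  have "meager_in (tuples (Suc n)) (topspace (tuples (Suc n)) - ?C)"
    using c by (simp add: generic_def comeager_in_def)
  then have N: "meager_in (prod_topology (tuples n) T) (?\<psi> ` (topspace (tuples (Suc n)) - ?C))"
    by (rule meager_in_homeomorphic_image[OF hom])
  obtain \<B> where \<B>: "countable \<B>" "\<And>U. U \<in> \<B> \<Longrightarrow> openin T U \<and> U \<noteq> {}"
    "\<And>V. openin T V \<Longrightarrow> V \<noteq> {} \<Longrightarrow> \<exists>U\<in>\<B>. U \<subseteq> V"
    using countable_base_T by auto
  define E where "E = {w \<in> topspace (tuples n).
      \<not> meager_in T {y. (w, y) \<in> ?\<psi> ` (topspace (tuples (Suc n)) - ?C)}}"
  have "meager_in (tuples n) E"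
    unfolding E_def using \<B> N by (rule Kuratowski_Ulam_meager)
  then have "meager_in (tuples n) (topspace (tuples n) - (topspace (tuples n) - E))"
    by (rule meager_in_subset) blast
  moreover have "meager_in (tuples n) (topspace (tuples n) - conj_orbit n x)"
    using x by (simp add: generic_def comeager_in_def)
  ultimately obtain w where w: "w \<in> topspace (tuples n)" "w \<notin> E" "w \<in> conj_orbit n x"
    using comeager_meets_comeager[of n "topspace (tuples n) - E" "conj_orbit n x"] by auto
  obtain g where g: "g \<in> G" "w = conj_tuple n g x"
    using w(3) by (auto simp: conj_orbit_def)
  have C_generic: "generic (Suc n) z" if "z \<in> ?C" for z
    using that generic_conj_tuple[OF c] by (auto simp: conj_orbit_def)
  let ?M = "{y. (w, y) \<in> ?\<psi> ` (topspace (tuples (Suc n)) - ?C)}"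
  have M: "meager_in T ?M"
    using w(1,2) by (simp add: E_def)
  have hom': "homeomorphic_map T T (\<lambda>f. inv g \<circ> f \<circ> inv (inv g))"
    using homeomorphic_translation[OF inv_mem[OF g(1)] inv_mem[OF inv_mem[OF g(1)]]] .
  have "G - {y. generic (Suc n) (x(n := y))} \<subseteq> (\<lambda>f. inv g \<circ> f \<circ> inv (inv g)) ` ?M"
  proof
    fix y assume y: "y \<in> G - {y. generic (Suc n) (x(n := y))}"
    define v where "v = g \<circ> y \<circ> inv g"
    have vG: "v \<in> G" using y g(1) comp_mem inv_mem by (simp add: v_def)
    have "w(n := v) \<notin> ?C"
    proof
      assume "w(n := v) \<in> ?C"
      then have "generic (Suc n) (conj_tuple (Suc n) g (x(n := y)))"
        using C_generic g(2) by (simp add: conj_tuple_append v_def)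
      then have "generic (Suc n) (conj_tuple (Suc n) (inv g) (conj_tuple (Suc n) g (x(n := y))))"
        using inv_mem[OF g(1)] by (rule generic_conj_tuple)
      then show False
        using y conj_tuple_inv(1)[OF g(1) append_mem[OF xt]] by simp
    qed
    moreover have "w(n := v) \<in> topspace (tuples (Suc n))"
      by (rule append_mem[OF w(1) vG])
    moreover have "?\<psi> (w(n := v)) = (w, v)"
      using restrict_append[OF w(1)] by simp
    ultimately have "(w, v) \<in> ?\<psi> ` (topspace (tuples (Suc n)) - ?C)"
      by (intro rev_image_eqI[of "w(n := v)"]) auto
    then have "v \<in> ?M" by simp
    show "y \<in> (\<lambda>f. inv g \<circ> f \<circ> inv (inv g)) ` ?M"
    proof (rule image_eqI[where x = v])
      show "y = inv g \<circ> v \<circ> inv (inv g)"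
        using g(1) by (simp add: v_def fun_eq_iff inv_inv)
    qed fact
  qed
  then show ?thesis
    by (rule meager_in_subset[OF meager_in_homeomorphic_image[OF hom' M]])
qed

text \<open>
  First \<open>y0\<close> is chosen in \<open>A\<close> such that \<open>(x, y0)\<close> is generic. By Effros' theorem, every generic
  \<open>(x, y)\<close> near it is its conjugate by an element of \<open>stab m\<close>, and \<open>B\<close> contains such \<open>y\<close>. The
  conjugating element centralizes \<open>x\<close>, the common part of the two tuples.
\<close>

lemma generic_append_pair:
  assumes x: "generic n x" and c: "generic (Suc n) c"
    and A: "A \<subseteq> G" "\<not> meager_in T A"
    and B: "\<And>U. openin T U \<Longrightarrow> U \<noteq> {} \<Longrightarrow> \<not> meager_in T (B \<inter> U)"
  shows "\<exists>y0\<in>A. \<exists>y1\<in>B. \<exists>f\<in>stab m.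
    generic (Suc n) (x(n := y0)) \<and> generic (Suc n) (x(n := y1)) \<and>
    conj_tuple n f x = x \<and> f \<circ> y1 \<circ> inv f = y0"
proof -
  let ?D = "{y. generic (Suc n) (x(n := y))}"
  have xt: "x \<in> topspace (tuples n)"
    using x by (simp add: generic_def)
  have D: "meager_in T (G - ?D)"
    using x c by (rule generic_append_comeager)
  have "\<not> A \<subseteq> G - ?D"
    using meager_in_subset[OF D, of A] A(2) by metis
  then obtain y0 where y0: "y0 \<in> A" "generic (Suc n) (x(n := y0))"
    using A(1) by blast
  let ?z = "x(n := y0)"
  have zt: "?z \<in> topspace (tuples (Suc n))" using y0(2) by (simp add: generic_def)
  obtain U where U: "openin (tuples (Suc n)) U" "?z \<in> U"
    "\<And>y. y \<in> U \<inter> conj_orbit (Suc n) ?z \<Longrightarrow> \<exists>g\<in>stab m. y = conj_tuple (Suc n) g ?z"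
    using Effros_conj_orbit[OF zt generic_not_meager[OF y0(2)], of m] by auto
  let ?V = "{y \<in> topspace T. x(n := y) \<in> U}"
  have "openin T ?V"
    using continuous_append[OF xt] U(1) by (rule openin_continuous_map_preimage)
  moreover have "y0 \<in> ?V" using y0(1) A(1) U(2) by auto
  ultimately have "\<not> meager_in T (B \<inter> ?V)"
    using B[of ?V] by auto
  then have "\<not> B \<inter> ?V \<subseteq> G - ?D"
    using meager_in_subset[OF D, of "B \<inter> ?V"] by metis
  then obtain y1 where y1: "y1 \<in> B" "x(n := y1) \<in> U" "generic (Suc n) (x(n := y1))"
    by auto
  have "x(n := y1) \<in> conj_orbit (Suc n) ?z"
    using generic_same_orbit[OF y0(2) y1(3)] .
  then obtain g where g: "g \<in> stab m" "x(n := y1) = conj_tuple (Suc n) g ?z"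
    using U(3) y1(2) by blast
  have gG: "g \<in> G" using g(1) stab_subset by auto
  have eq: "?z = conj_tuple (Suc n) (inv g) (x(n := y1))"
    using g(2) conj_tuple_inv(1)[OF gG zt] by simp
  have "conj_tuple n (inv g) x = x"
  proof
    fix j
    show "conj_tuple n (inv g) x j = x j"
    proof (cases "j < n")
      case True
      then show ?thesis using fun_cong[OF eq, of j] by (simp add: conj_tuple_append)
    next
      case False
      then show ?thesis using xt by (simp add: conj_tuple_def PiE_iff extensional_def)
    qed
  qed
  moreover have "inv g \<circ> y1 \<circ> inv (inv g) = y0"
    using fun_cong[OF eq, of n] by (simp add: conj_tuple_append)
  ultimately show ?thesis
    using y0 y1 inv_stab[OF g(1)] by blast
qed

section \<open>A tree of conjugators\<close>

text \<open>
  A node at level \<open>n\<close> of the binary tree carries a generic tuple \<open>X\<close> of length \<open>Suc n\<close> and a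
  permutation \<open>P\<close>. Its children extend \<open>X\<close> by the elements \<open>y0\<close> and \<open>y1\<close> of \<open>generic_append_pair\<close>,
  where \<open>y0 = f y1 f\<inverse>\<close>. The left child keeps \<open>P\<close> and the right child has \<open>P f\<close>, so that conjugation by
  the permutation of the child takes \<open>y0\<close> and \<open>y1\<close> to the same element. The later factors on a branch
  centralize the tuple of the node, so this remains true for the limit \<open>h a\<close> of the permutations
  along the branch \<open>a\<close>.
\<close>

lemma tree_of_conjugators:
  assumes c: "\<And>n. \<exists>c. generic (Suc n) c"
    and A: "\<And>n. A n \<subseteq> G" "\<And>n. \<not> meager_in T (A n)"
    and B: "\<And>n U. openin T U \<Longrightarrow> U \<noteq> {} \<Longrightarrow> \<not> meager_in T (B n \<inter> U)"
  shows "\<exists>h :: (nat \<Rightarrow> bool) \<Rightarrow> nat \<Rightarrow> nat. (\<forall>a. h a \<in> G) \<and>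
    (\<forall>a b n. (\<forall>i<n. a i = b i) \<longrightarrow> \<not> a n \<longrightarrow> b n \<longrightarrow>
      (\<exists>y0\<in>A n. \<exists>y1\<in>B n. h a \<circ> y0 \<circ> inv (h a) = h b \<circ> y1 \<circ> inv (h b)))"
proof -
  have "\<exists>y0 y1 f. generic (Suc n) x \<longrightarrow> y0 \<in> A n \<and> y1 \<in> B n \<and> f \<in> stab m \<and>
      generic (Suc (Suc n)) (x(Suc n := y0)) \<and> generic (Suc (Suc n)) (x(Suc n := y1)) \<and>
      conj_tuple (Suc n) f x = x \<and> f \<circ> y1 \<circ> inv f = y0" for n x m
  proof (cases "generic (Suc n) x")
    case True
    obtain c where "generic (Suc (Suc n)) c" using c by blast
    then show ?thesis
      using generic_append_pair[OF True _ A(1,2) B, of c n n m] by blast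
  qed simp
  then obtain Y0 Y1 F where choice: "\<And>n x m. generic (Suc n) x \<Longrightarrow>
      Y0 n x m \<in> A n \<and> Y1 n x m \<in> B n \<and> F n x m \<in> stab m \<and>
      generic (Suc (Suc n)) (x(Suc n := Y0 n x m)) \<and> generic (Suc (Suc n)) (x(Suc n := Y1 n x m)) \<and>
      conj_tuple (Suc n) (F n x m) x = x \<and> F n x m \<circ> Y1 n x m \<circ> inv (F n x m) = Y0 n x m"
    by metis
  obtain c0 where c0: "generic (Suc 0) c0" using c by blast
  \<comment> \<open>Large enough that multiplying \<open>P\<close> on the right by an element of \<open>stab (M n P)\<close> keeps the first
    \<open>n\<close> values of \<open>P\<close> and of its inverse.\<close>
  define M where "M n P = n + (\<Sum>k<n. Suc (inv P k))" for n and P :: "nat \<Rightarrow> nat"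
  have M_gt: "inv P k < M n P" if "k < n" for P k n
    using member_le_sum[of k "{..<n}" "\<lambda>k. Suc (inv P k)"] that by (simp add: M_def)
  define step where "step = (\<lambda>n b (x, P). if b then (x(Suc n := Y1 n x (M n P)), P \<circ> F n x (M n P))
      else (x(Suc n := Y0 n x (M n P)), P))"
  define S where "S a = rec_nat (c0, id) (\<lambda>n. step n (a n))" for a
  define X where "X a n = fst (S a n)" for a n
  define P where "P a n = snd (S a n)" for a n
  have S0: "X a 0 = c0" "P a 0 = id" for a
    by (simp_all add: X_def P_def S_def)
  have SSuc: "X a (Suc n) = (X a n)(Suc n := (if a n then Y1 n (X a n) (M n (P a n)) else Y0 n (X a n) (M n (P a n))))"
    "P a (Suc n) = (if a n then P a n \<circ> F n (X a n) (M n (P a n)) else P a n)" for a n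
    by (simp_all add: X_def P_def S_def step_def case_prod_unfold)
  have gen: "generic (Suc n) (X a n)" for a n
  proof (induction n)
    case 0
    then show ?case by (simp add: S0 c0)
  next
    case (Suc n)
    show ?case
      using choice[OF Suc, of "M n (P a n)"] unfolding SSuc by (cases "a n") (simp_all only: if_True if_False)
  qed
  have F_stab: "F n (X a n) (M n (P a n)) \<in> stab (M n (P a n))" for a n
    using choice[OF gen] by blast
  have F_G: "F n (X a n) (M n (P a n)) \<in> G" for a n
    using subsetD[OF stab_subset F_stab] .
  have PG: "P a n \<in> G" for a n
  proof (induction n)
    case 0
    show ?case unfolding S0 by (rule id_mem)
  next
    case (Suc n)
    then show ?case by (simp add: SSuc comp_mem F_G)
  qed
  have Pstep: "P a (Suc i) k = P a i k \<and> inv (P a (Suc i)) k = inv (P a i) k" if "k < i" for a i k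
  proof (cases "a i")
    case True
    let ?f = "F i (X a i) (M i (P a i))"
    have "k < M i (P a i)" using that by (simp add: M_def)
    then have "?f k = k" using F_stab[of i a] by (simp add: stab_def)
    moreover have "inv ?f (inv (P a i) k) = inv (P a i) k"
      using inv_stab[OF F_stab[of i a]] M_gt[OF that] by (simp add: stab_def)
    ultimately show ?thesis
      using True inv_comp[OF PG F_G] by (simp add: SSuc)
  qed (simp add: SSuc)
  have "\<exists>p\<in>G. \<forall>i k. k < i \<longrightarrow> P a i k = p k \<and> inv (P a i) k = inv p k" for a
    by (rule limit_of_stabilizing[of "P a", OF PG Pstep])
  then obtain h where h: "\<And>a. h a \<in> G"
    "\<And>a i k. k < i \<Longrightarrow> P a i k = h a k \<and> inv (P a i) k = inv (h a) k"
    by metis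
  have X_mono: "X a i j = X a n j" if "n \<le> i" "j < Suc n" for a n i j
    using that by (induction i rule: dec_induct) (simp_all add: SSuc)
  \<comment> \<open>Beyond level \<open>n\<close>, all factors centralize the tuple at level \<open>n\<close>.\<close>
  have stable: "conj_tuple (Suc n) (P a i) (X a n) = conj_tuple (Suc n) (P a n) (X a n)" if "n \<le> i" for a n i
    using that
  proof (induction i rule: dec_induct)
    case (step i)
    let ?f = "F i (X a i) (M i (P a i))"
    have "conj_tuple (Suc n) ?f (X a n) = X a n"
    proof
      fix j
      show "conj_tuple (Suc n) ?f (X a n) j = X a n j"
      proof (cases "j < Suc n")
        case True
        have "conj_tuple (Suc i) ?f (X a i) = X a i"
          using choice[OF gen] by blast
        then have "conj_tuple (Suc i) ?f (X a i) j = X a i j"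
          by simp
        then show ?thesis
          using True X_mono[OF step.hyps(1) True, of a] step.hyps(1) by (simp add: conj_tuple_apply)
      next
        case False
        then show ?thesis
          using gen[of n a] by (simp add: conj_tuple_def generic_def PiE_iff extensional_def)
      qed
    qed
    then have "conj_tuple (Suc n) (P a i \<circ> ?f) (X a n) = conj_tuple (Suc n) (P a i) (X a n)"
      using conj_tuple_comp[OF PG F_G] by metis
    then show ?case using step.IH by (simp add: SSuc)
  qed simp
  have h_conj: "conj_tuple (Suc n) (h a) (X a n) = conj_tuple (Suc n) (P a n) (X a n)" for a n
  proof (intro ext)
    fix j k
    show "conj_tuple (Suc n) (h a) (X a n) j k = conj_tuple (Suc n) (P a n) (X a n) j k"
    proof (cases "j < Suc n")
      case True
      have "eventually (\<lambda>i. conj_tuple (Suc n) (P a i) (X a n) j k = conj_tuple (Suc n) (h a) (X a n) j k) sequentially"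
        by (rule conj_tuple_limit[where P = "P a" and p = "h a", OF h(2) True])
      moreover have "eventually (\<lambda>i. conj_tuple (Suc n) (P a i) (X a n) j k = conj_tuple (Suc n) (P a n) (X a n) j k) sequentially"
        using eventually_ge_at_top[of n]
        by (rule eventually_mono) (rule fun_cong[OF fun_cong[OF stable]])
      ultimately have "eventually (\<lambda>i::nat. conj_tuple (Suc n) (h a) (X a n) j k = conj_tuple (Suc n) (P a n) (X a n) j k) sequentially"
        by eventually_elim (erule (1) trans[OF sym])
      then show ?thesis by simp
    qed (simp add: conj_tuple_def)
  qed
  have "\<exists>y0\<in>A n. \<exists>y1\<in>B n. h a \<circ> y0 \<circ> inv (h a) = h b \<circ> y1 \<circ> inv (h b)"
    if ab: "\<forall>i<n. a i = b i" "\<not> a n" "b n" for a b n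
  proof -
    have "S a i = S b i" if "i \<le> n" for i
      using that by (induction i) (use ab(1) in \<open>simp_all add: S_def\<close>)
    then have XP: "X a n = X b n" "P a n = P b n" by (simp_all add: X_def P_def)
    let ?x = "X b n" and ?P = "P b n"
    let ?m = "M n ?P"
    let ?y0 = "Y0 n ?x ?m" and ?y1 = "Y1 n ?x ?m" and ?f = "F n ?x ?m"
    have ch: "?y0 \<in> A n" "?y1 \<in> B n" "?f \<circ> ?y1 \<circ> inv ?f = ?y0"
      using choice[OF gen] by auto
    have "h a \<circ> ?y0 \<circ> inv (h a) = ?P \<circ> ?y0 \<circ> inv ?P"
      using fun_cong[OF h_conj[of "Suc n" a], of "Suc n"] ab(2) by (simp add: conj_tuple_apply SSuc XP)
    also have "\<dots> = (?P \<circ> ?f) \<circ> ?y1 \<circ> inv (?P \<circ> ?f)"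
      unfolding ch(3)[symmetric] inv_comp[OF PG F_G] by (simp add: o_assoc)
    also have "\<dots> = h b \<circ> ?y1 \<circ> inv (h b)"
      using fun_cong[OF h_conj[of "Suc n" b], of "Suc n"] ab(3) by (simp add: conj_tuple_apply SSuc)
    finally show ?thesis using ch by blast
  qed
  then show ?thesis using h(1) by (intro exI[of _ h]) auto
qed

section \<open>Open subgroups inside products of sets\<close>

text \<open>
  \<open>U\<close> contains a left coset \<open>B\<close> of some \<open>stab m\<close>, and right translation by \<open>v \<in> stab m\<close> maps \<open>B\<close>
  to itself. Since \<open>W\<close> and its translate by \<open>v\<close> are both comeager in the nonmeager set \<open>B\<close>, they meet.
\<close>

lemma Pettis_stab:
  assumes U: "openin T U" "U \<noteq> {}" and W: "meager_in T (U - W)"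
  shows "\<exists>m. \<forall>v\<in>stab m. \<exists>w\<in>W. \<exists>w'\<in>W. v = inv w' \<circ> w"
proof -
  obtain g0 where g0: "g0 \<in> U" using U(2) by blast
  then have g0G: "g0 \<in> G" using openin_subset[OF U(1)] by auto
  obtain m where m: "{f \<in> G. \<forall>k<m. f k = g0 k} \<subseteq> U"
    using openin_T_imp_agree[OF U(1) g0] by blast
  let ?B = "{f \<in> G. \<forall>k<m. f k = g0 k}"
  have B_nm: "\<not> meager_in T ?B"
    using not_meager_in_openin[OF completely_metrizable_T openin_T_agree] g0G by blast
  have BW: "meager_in T (?B - W)"
    using W by (rule meager_in_subset) (use m in blast)
  have "\<exists>w\<in>W. \<exists>w'\<in>W. v = inv w' \<circ> w" if v: "v \<in> stab m" for v
  proof -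
    have vG: "v \<in> G" using v stab_subset by auto
    have v': "inv v \<in> stab m" "inv v \<in> G" using inv_stab[OF v] stab_subset by auto
    let ?R = "\<lambda>f. id \<circ> f \<circ> v"
    have "meager_in T (?R ` (?B - W))"
      using meager_in_homeomorphic_image[OF homeomorphic_translation[OF id_mem vG] BW] .
    then have "\<not> ?B \<subseteq> (?B - W) \<union> ?R ` (?B - W)"
      using meager_in_subset[OF meager_in_Un[OF BW], of "?R ` (?B - W)" ?B] B_nm by metis
    then obtain w where w: "w \<in> ?B" "w \<in> W" "w \<notin> ?R ` (?B - W)" by blast
    have "w \<circ> inv v \<in> ?B"
      using w(1) v' comp_mem by (simp add: stab_def)
    moreover have "?R (w \<circ> inv v) = w"
      using vG by (simp add: fun_eq_iff)
    ultimately have "w \<circ> inv v \<in> W"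
      using w(3) by (metis (mono_tags, lifting) DiffI rev_image_eqI)
    moreover have "v = inv (w \<circ> inv v) \<circ> w"
      using w(1) vG v' by (simp add: inv_comp inv_inv fun_eq_iff)
    ultimately show ?thesis using w(2) by blast
  qed
  then show ?thesis by blast
qed

abbreviation products :: "(nat \<Rightarrow> nat) set \<Rightarrow> nat \<Rightarrow> (nat \<Rightarrow> nat) set" where
  "products \<equiv> set_power (subgroup_monoid G)"

lemma products_subset: "W \<subseteq> G \<Longrightarrow> products W k \<subseteq> G"
proof (induction k)
  case (Suc k)
  then show ?case
    using comp_mem S_inf_mult bij by (auto simp: set_mult_def subset_iff)
qed (simp add: S_inf_one id_mem)

lemma products_0: "products W 0 = {id}"
  by (simp add: S_inf_one)

lemma mem_products_Suc:
  assumes "W \<subseteq> G"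
  shows "f \<in> products W (Suc k) \<longleftrightarrow> (\<exists>g\<in>products W k. \<exists>w\<in>W. f = g \<circ> w)"
proof -
  have "g \<otimes>\<^bsub>S_inf\<^esub> w = g \<circ> w" if "g \<in> products W k" "w \<in> W" for g w
    using that products_subset[OF assms] assms bij by (intro S_inf_mult) auto
  then show ?thesis
    by (auto simp: set_mult_def)
qed

lemma products_1: "W \<subseteq> G \<Longrightarrow> w \<in> W \<Longrightarrow> w \<in> products W (Suc 0)"
  by (simp add: mem_products_Suc products_0 del: set_power.simps)

lemma products_add:
  assumes W: "W \<subseteq> G" and f: "f \<in> products W j" and g: "g \<in> products W k"
  shows "f \<circ> g \<in> products W (j + k)"
  using g
proof (induction k arbitrary: g)
  case 0
  then have "g = id" by (simp only: products_0 singleton_iff)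
  then show ?case using f by simp
next
  case (Suc k)
  then obtain h w where h: "h \<in> products W k" "w \<in> W" "g = h \<circ> w"
    using mem_products_Suc[OF W] by blast
  have "f \<circ> g = (f \<circ> h) \<circ> w"
    unfolding h(3) by (rule o_assoc)
  then have "f \<circ> g \<in> products W (Suc (j + k))"
    unfolding mem_products_Suc[OF W] using Suc.IH[OF h(1)] h(2) by blast
  then show ?case by (simp only: add_Suc_right)
qed

lemma products_inv:
  assumes W: "W \<subseteq> G" and sym: "\<And>w. w \<in> W \<Longrightarrow> inv w \<in> W" and f: "f \<in> products W k"
  shows "inv f \<in> products W k"
  using f
proof (induction k arbitrary: f)
  case 0
  then have "f = id" by (simp only: products_0 singleton_iff)
  then show ?case by (simp only: products_0 inv_id singleton_iff)
next
  case (Suc k)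
  then obtain h w where h: "h \<in> products W k" "w \<in> W" "f = h \<circ> w"
    using mem_products_Suc[OF W] by blast
  have "inv f = inv w \<circ> inv h"
    unfolding h(3) using subsetD[OF products_subset[OF W] h(1)] subsetD[OF W h(2)] by (rule inv_comp)
  moreover have "inv w \<circ> inv h \<in> products W (Suc 0 + k)"
    using products_add[OF W products_1[OF W sym[OF h(2)]] Suc.IH[OF h(1)]] .
  ultimately show ?case by (simp only: add_Suc add_0)
qed

lemma products_mono:
  assumes "W \<subseteq> W'" "W' \<subseteq> G"
  shows "products W k \<subseteq> products W' k"
proof (induction k)
  case (Suc k)
  have "W \<subseteq> G" using assms by blast
  show ?case
  proof
    fix f assume "f \<in> products W (Suc k)"
    then obtain g w where "g \<in> products W k" "w \<in> W" "f = g \<circ> w"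
      using mem_products_Suc[OF \<open>W \<subseteq> G\<close>] by blast
    then show "f \<in> products W' (Suc k)"
      using Suc assms(1) mem_products_Suc[OF assms(2)] by blast
  qed
qed simp

text \<open>
  The argument by contradiction with the tree of conjugators for the sets \<open>V n\<close> and
  \<open>G - V n\<^sup>5\<close>, where \<open>V\<close> is a tail of \<open>W\<close> that consists of nonmeager sets. The exponent 5 is the
  number of factors in \<open>h\<^sub>b\<inverse> h\<^sub>a w h\<^sub>a\<inverse> h\<^sub>b\<close>, and 10 comes from a quotient of two products of length 5.
\<close>

lemma stab_subset_products:
  assumes c: "\<And>n. \<exists>c. generic (Suc n) c"
    and mono: "\<And>n. W n \<subseteq> W (Suc n)" and union: "(\<Union>n. W n) = G"
    and sym: "\<And>n w. w \<in> W n \<Longrightarrow> inv w \<in> W n"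
  shows "\<exists>n m. stab m \<subseteq> products (W n) 10"
proof (rule ccontr)
  assume neg: "\<not> ?thesis"
  have WG: "W n \<subseteq> G" for n using union by blast
  have W_mono: "W i \<subseteq> W j" if "i \<le> j" for i j
    using mono that by (rule lift_Suc_mono_le)
  have "\<not> meager_in T G"
    using not_meager_in_openin[OF completely_metrizable_T openin_topspace] id_mem by auto
  then obtain n0 where n0: "\<not> meager_in T (W n0)"
    using meager_in_Union[of "range W" T] union by auto
  define V where "V n = W (n0 + n)" for n
  have VG: "V n \<subseteq> G" for n using WG by (simp add: V_def)
  have V_mono: "V i \<subseteq> V j" if "i \<le> j" for i j
    using W_mono that by (simp add: V_def)
  have V_sym: "inv w \<in> V n" if "w \<in> V n" for n w
    using that sym by (simp add: V_def)
  have A: "\<not> meager_in T (V n)" for n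
    using n0 meager_in_subset[of T "V n" "W n0"] W_mono[of n0 "n0 + n"] by (auto simp: V_def)
  have B: "\<not> meager_in T ((G - products (V n) 5) \<inter> U)" if U: "openin T U" "U \<noteq> {}" for n U
  proof
    assume m: "meager_in T ((G - products (V n) 5) \<inter> U)"
    have "U \<subseteq> G" using openin_subset[OF U(1)] by simp
    then have "meager_in T (U - products (V n) 5)"
      by (intro meager_in_subset[OF m]) blast
    from Pettis_stab[OF U this]
    obtain m where m: "\<And>v. v \<in> stab m \<Longrightarrow> \<exists>w\<in>products (V n) 5. \<exists>w'\<in>products (V n) 5. v = inv w' \<circ> w"
      by auto
    have "stab m \<subseteq> products (V n) 10"
    proof
      fix v assume "v \<in> stab m"
      then obtain w w' where w: "w \<in> products (V n) 5" "w' \<in> products (V n) 5" "v = inv w' \<circ> w"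
        using m by blast
      show "v \<in> products (V n) 10"
        using products_add[OF VG products_inv[OF VG V_sym w(2)] w(1)] w(3) by simp
    qed
    then show False using neg by (auto simp: V_def)
  qed
  obtain h :: "(nat \<Rightarrow> bool) \<Rightarrow> nat \<Rightarrow> nat" where hG: "\<And>a. h a \<in> G"
    and h: "\<And>a b n. \<forall>i<n. a i = b i \<Longrightarrow> \<not> a n \<Longrightarrow> b n \<Longrightarrow>
      \<exists>y0\<in>V n. \<exists>y1\<in>G - products (V n) 5. h a \<circ> y0 \<circ> inv (h a) = h b \<circ> y1 \<circ> inv (h b)"
    using tree_of_conjugators[of V "\<lambda>n. G - products (V n) 5", OF c VG A B] by metis
  have no_split: False if ab: "h a \<in> V m" "h b \<in> V m" "\<forall>i<n. a i = b i" "\<not> a n" "b n" "m \<le> n" for a b m n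
  proof -
    obtain y0 y1 where y: "y0 \<in> V n" "y1 \<in> G - products (V n) 5" "h a \<circ> y0 \<circ> inv (h a) = h b \<circ> y1 \<circ> inv (h b)"
      using h[OF ab(3-5)] by blast
    have hV: "h a \<in> V n" "h b \<in> V n" using ab(1,2) V_mono[OF ab(6)] by auto
    have "y1 = inv (h b) \<circ> (h b \<circ> y1 \<circ> inv (h b)) \<circ> h b"
      using hG by (simp add: fun_eq_iff)
    also have "\<dots> = inv (h b) \<circ> h a \<circ> y0 \<circ> inv (h a) \<circ> h b"
      unfolding y(3)[symmetric] by (simp add: o_assoc)
    also have "\<dots> \<in> products (V n) (Suc 0 + Suc 0 + Suc 0 + Suc 0 + Suc 0)"
      by (intro products_add VG products_1 V_sym hV y(1))
    finally show False using y(2) by (simp add: numeral_eq_Suc)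
  qed
  \<comment> \<open>So the branches with \<open>h a \<in> V m\<close> are determined by their first \<open>m\<close> entries.\<close>
  have inj: "inj_on (\<lambda>a. map a [0..<m]) {a. h a \<in> V m}" for m
  proof (rule inj_onI, rule ccontr)
    fix a b assume ab: "a \<in> {a. h a \<in> V m}" "b \<in> {a. h a \<in> V m}" "map a [0..<m] = map b [0..<m]" "a \<noteq> b"
    define n where "n = (LEAST i. a i \<noteq> b i)"
    have "\<exists>i. a i \<noteq> b i" using ab(4) by auto
    then have n: "a n \<noteq> b n" "\<forall>i<n. a i = b i"
      unfolding n_def using LeastI_ex[of "\<lambda>i. a i \<noteq> b i"] not_less_Least[of _ "\<lambda>i. a i \<noteq> b i"] by blast+
    have "a i = b i" if "i < m" for i
      using ab(3) that by simp
    then have "m \<le> n" using n(1) by (meson not_le)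
    then show False
      using no_split[of a m b n] no_split[of b m a n] ab n by (cases "a n") auto
  qed
  have "countable {a. h a \<in> V m}" for m
    using countable_image_inj_on[OF _ inj] by auto
  moreover have "(\<Union>m. {a. h a \<in> V m}) = UNIV"
  proof -
    have "\<exists>m. h a \<in> V m" for a
    proof -
      obtain i where "h a \<in> W i" using hG union by blast
      then show ?thesis using W_mono[of i "n0 + i"] by (auto simp: V_def)
    qed
    then show ?thesis by auto
  qed
  ultimately show False
    using uncountable_UNIV_nat_bool countable_UN[of "UNIV :: nat set" "\<lambda>m. {a. h a \<in> V m}"] by simp
qed

section \<open>Oligomorphic groups\<close>

text \<open>
  The double coset of \<open>g\<close> modulo \<open>stab m\<close> is determined by the orbit of the tuple
  \<open>(0, \<dots>, m - 1, g 0, \<dots>, g (m - 1))\<close>: an element \<open>u\<close> that maps the tuple of \<open>f\<close> to that of \<open>g\<close>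
  fixes \<open>0, \<dots>, m - 1\<close>, and \<open>u f\<close> and \<open>g\<close> have the same first \<open>m\<close> values. There are finitely many
  orbits of tuples of length \<open>2 m\<close>.
\<close>

lemma oligomorphic_double_cosets:
  assumes "oligomorphic G"
  shows "\<exists>F. finite F \<and> F \<subseteq> G \<and> (\<forall>g\<in>G. \<exists>u\<in>stab m. \<exists>f\<in>F. \<exists>v\<in>stab m. g = u \<circ> f \<circ> v)"
proof -
  define t where "t g = [0..<m] @ map g [0..<m]" for g
  define \<phi> where "\<phi> g = orbit (subgroup_monoid G) map (t g)" for g
  have "\<phi> ` G \<subseteq> orbits (subgroup_monoid G) {xs. length xs = 2 * m} map"
    by (auto simp: \<phi>_def orbits_def t_def)
  then have fin: "finite (\<phi> ` G)"
    by (rule finite_subset) (use assms in \<open>simp add: oligomorphic_def\<close>)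
  define r where "r O' = (SOME g. g \<in> G \<and> \<phi> g = O')" for O'
  have r: "r (\<phi> g) \<in> G" "\<phi> (r (\<phi> g)) = \<phi> g" if "g \<in> G" for g
    using someI[of "\<lambda>g'. g' \<in> G \<and> \<phi> g' = \<phi> g" g] that by (auto simp: r_def)
  have "\<exists>u\<in>stab m. \<exists>f\<in>r ` \<phi> ` G. \<exists>v\<in>stab m. g = u \<circ> f \<circ> v" if g: "g \<in> G" for g
  proof -
    let ?f = "r (\<phi> g)"
    have "t g \<in> \<phi> g"
      using id_mem by (auto simp: \<phi>_def orbit_def intro!: exI[of _ id])
    then have "t g \<in> \<phi> ?f" using r(2)[OF g] by simp
    then obtain u where u: "u \<in> G" "t g = map u (t ?f)"
      by (auto simp: \<phi>_def orbit_def)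
    have "[0..<m] = map u [0..<m]" "map g [0..<m] = map u (map ?f [0..<m])"
      using u(2) by (simp_all add: t_def)
    then have u': "u k = k" "u (?f k) = g k" if "k < m" for k
      using that by (auto simp: list_eq_iff_nth_eq)
    have us: "u \<in> stab m" using u(1) u'(1) by (simp add: stab_def)
    have "inv ?f (inv u (g k)) = k" if "k < m" for k
      unfolding u'(2)[OF that, symmetric] using u(1) r(1)[OF g] by simp
    then have "inv ?f \<circ> inv u \<circ> g \<in> stab m"
      using u(1) r(1)[OF g] g comp_mem inv_mem by (simp add: stab_def)
    moreover have "g = u \<circ> ?f \<circ> (inv ?f \<circ> inv u \<circ> g)"
      using u(1) r(1)[OF g] by (simp add: fun_eq_iff)
    ultimately show ?thesis using us g by blast
  qed
  moreover have "r ` \<phi> ` G \<subseteq> G" using r(1) by auto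
  ultimately show ?thesis
    using fin by (intro exI[of _ "r ` \<phi> ` G"]) auto
qed

section \<open>The Bergman property\<close>

lemma subgroup_monoid_inv:
  assumes "g \<in> G"
  shows "m_inv (subgroup_monoid G) g = inv g"
  unfolding m_inv_def
proof (rule the_equality)
  have "g \<circ> inv g = id" "inv g \<circ> g = id"
    using assms by (auto simp: fun_eq_iff)
  then show "inv g \<in> carrier (subgroup_monoid G) \<and> g \<otimes>\<^bsub>subgroup_monoid G\<^esub> inv g = \<one>\<^bsub>subgroup_monoid G\<^esub> \<and>
      inv g \<otimes>\<^bsub>subgroup_monoid G\<^esub> g = \<one>\<^bsub>subgroup_monoid G\<^esub>"
    using assms inv_mem[OF assms] by (simp add: S_inf_mult S_inf_one bij)
next
  fix y assume y: "y \<in> carrier (subgroup_monoid G) \<and> g \<otimes>\<^bsub>subgroup_monoid G\<^esub> y = \<one>\<^bsub>subgroup_monoid G\<^esub> \<and>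
      y \<otimes>\<^bsub>subgroup_monoid G\<^esub> g = \<one>\<^bsub>subgroup_monoid G\<^esub>"
  then have "g \<circ> y = id" "y \<circ> g = id"
    using assms by (auto simp: S_inf_mult S_inf_one bij)
  then show "y = inv g"
    by (rule inv_unique_comp[symmetric])
qed

lemma diag_conj_eq:
  assumes "g \<in> G" "x \<in> topspace (tuples n)"
  shows "diag_conj (subgroup_monoid G) n g x = conj_tuple n g x"
  unfolding diag_conj_def conj_tuple_def subgroup_monoid_inv[OF assms(1)]
proof (rule restrict_ext)
  fix j assume "j \<in> {..<n}"
  then have "x j \<in> G" using assms(2) by (auto simp: PiE_iff)
  then show "g \<otimes>\<^bsub>subgroup_monoid G\<^esub> x j \<otimes>\<^bsub>subgroup_monoid G\<^esub> inv g = g \<circ> x j \<circ> inv g"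
    using assms(1) comp_mem inv_mem by (simp add: S_inf_mult bij)
qed

lemma ample_generics_imp_generic:
  assumes "ample_generics (subgroup_monoid G) (top_of_set G)"
  shows "\<exists>c. generic (Suc n) c"
proof -
  obtain C where C: "C \<in> orbits (subgroup_monoid G) ({..<Suc n} \<rightarrow>\<^sub>E G) (diag_conj (subgroup_monoid G) (Suc n))"
    "comeager_in (tuples (Suc n)) C"
    using assms by (auto simp: ample_generics_def)
  then obtain c where c: "c \<in> topspace (tuples (Suc n))"
    "C = orbit (subgroup_monoid G) (diag_conj (subgroup_monoid G) (Suc n)) c"
    by (auto simp: orbits_def)
  have "C = conj_orbit (Suc n) c"
  proof -
    have "C = (\<lambda>g. diag_conj (subgroup_monoid G) (Suc n) g c) ` G"
      unfolding c(2) by (auto simp: orbit_def)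
    then show ?thesis
      by (simp only: conj_orbit_def image_cong[OF refl diag_conj_eq[OF _ c(1)]])
  qed
  then show ?thesis
    using c(1) C(2) by (auto simp: generic_def)
qed

lemma bergman_property_if_generic_tuples:
  assumes olig: "oligomorphic G" and c: "\<And>n. \<exists>c. generic (Suc n) c"
  shows "bergman_property (subgroup_monoid G)"
  unfolding bergman_property_def
proof (intro allI impI, elim conjE)
  fix W :: "nat \<Rightarrow> (nat \<Rightarrow> nat) set"
  assume mono: "\<forall>n. W n \<subseteq> W (Suc n)" and union: "(\<Union>n. W n) = carrier (subgroup_monoid G)"
  have "W n \<subseteq> W (Suc n)" for n using mono by simp
  then have W_mono: "W i \<subseteq> W j" if "i \<le> j" for i j
    using that by (rule lift_Suc_mono_le)
  define V where "V n = {w \<in> W n. inv w \<in> W n}" for n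
  have WG: "W n \<subseteq> G" for n using union by auto
  have VG: "V n \<subseteq> G" for n using WG by (auto simp: V_def)
  have V_mono: "V i \<subseteq> V j" if "i \<le> j" for i j
    using W_mono[OF that] by (auto simp: V_def)
  have V_sym: "inv w \<in> V n" if "w \<in> V n" for w n
    using that inv_inv[OF subsetD[OF VG that]] by (simp add: V_def)
  have V_union: "(\<Union>n. V n) = G"
  proof
    show "(\<Union>n. V n) \<subseteq> G" using VG by blast
    show "G \<subseteq> (\<Union>n. V n)"
    proof
      fix g assume g: "g \<in> G"
      obtain i j where "g \<in> W i" "inv g \<in> W j" using g inv_mem[OF g] union by auto
      then have "g \<in> V (max i j)"
        using W_mono[of i "max i j"] W_mono[of j "max i j"] by (auto simp: V_def)
      then show "g \<in> (\<Union>n. V n)" by blast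
    qed
  qed
  obtain n m where nm: "stab m \<subseteq> products (V n) 10"
    using stab_subset_products[of V, OF c V_mono V_union V_sym] by auto
  obtain F where "finite F \<and> F \<subseteq> G \<and> (\<forall>g\<in>G. \<exists>u\<in>stab m. \<exists>f\<in>F. \<exists>v\<in>stab m. g = u \<circ> f \<circ> v)"
    using oligomorphic_double_cosets[OF olig, of m] by (rule exE)
  then have F: "finite F" "F \<subseteq> G" "\<forall>g\<in>G. \<exists>u\<in>stab m. \<exists>f\<in>F. \<exists>v\<in>stab m. g = u \<circ> f \<circ> v"
    by simp_all
  have "\<exists>N. F \<subseteq> V N"
    using F(1,2)
  proof (induction F rule: finite_induct)
    case (insert f F)
    then obtain N i where "F \<subseteq> V N" "f \<in> V i" using V_union by auto
    then have "insert f F \<subseteq> V (max N i)"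
      using V_mono[of N "max N i"] V_mono[of i "max N i"] by auto
    then show ?case by blast
  qed simp
  then obtain N where N: "F \<subseteq> V N" by blast
  let ?k = "max n N"
  have stab_pow: "stab m \<subseteq> products (V ?k) 10"
    using products_mono[OF V_mono[of n ?k] VG] by (intro subset_trans[OF nm]) simp
  have FV: "F \<subseteq> V ?k" using N V_mono[of N ?k] by auto
  have "G \<subseteq> products (V ?k) 21"
  proof
    fix g assume "g \<in> G"
    then obtain u f v where uv: "u \<in> stab m" "f \<in> F" "v \<in> stab m" and g: "g = u \<circ> f \<circ> v"
      using F(3) by metis
    have "u \<in> products (V ?k) 10" "f \<in> products (V ?k) (Suc 0)" "v \<in> products (V ?k) 10"
      using subsetD[OF stab_pow uv(1)] products_1[OF VG subsetD[OF FV uv(2)]] subsetD[OF stab_pow uv(3)] .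
    then have "g \<in> products (V ?k) (10 + Suc 0 + 10)"
      unfolding g by (intro products_add VG)
    then show "g \<in> products (V ?k) 21" by (simp del: set_power.simps)
  qed
  also have "products (V ?k) 21 \<subseteq> products (W ?k) 21"
    by (intro products_mono WG) (auto simp: V_def)
  finally have "products (W ?k) 21 = G"
    using products_subset[OF WG] by (intro subset_antisym)
  then show "\<exists>n k. products (W n) k = carrier (subgroup_monoid G)"
    by (intro exI[of _ ?k] exI[of _ 21]) (simp del: set_power.simps)
qed

end

lemma closed_perm_group_of_subgroup:
  assumes "closed_subgroup_S_inf G"
  shows "closed_perm_group G"
proof
  have sub: "subgroup G S_inf" and cl: "closedin (top_of_set (carrier S_inf)) G"
    using assms by (auto simp: closed_subgroup_S_inf_def)
  show bij: "bij g" if "g \<in> G" for g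
    using subgroup.subset[OF sub] that by (auto simp: S_inf_carrier)
  show "id \<in> G"
    using subgroup.one_closed[OF sub] by (simp add: S_inf_one)
  show "g \<circ> h \<in> G" if "g \<in> G" "h \<in> G" for g h
    using subgroup.m_closed[OF sub that] S_inf_mult[OF bij[OF that(1)] bij[OF that(2)]] by simp
  show "inv g \<in> G" if "g \<in> G" for g
  proof -
    have "m_inv S_inf g = inv g"
      using bij[OF that] by (simp add: S_inf_def inv_BijGroup Bij_def fun_eq_iff)
    then show ?thesis
      using subgroup.m_inv_closed[OF sub that] by simp
  qed
  show "closedin (top_of_set {f. bij f}) G"
    using cl by (simp add: S_inf_carrier)
qed

theorem theorem1p8:
  fixes G :: "(nat \<Rightarrow> nat) set"
  assumes "closed_subgroup_S_inf G"
    and "oligomorphic G"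
    and "ample_generics (subgroup_monoid G) (top_of_set G)"
  shows "bergman_property (subgroup_monoid G)"
proof -
  interpret closed_perm_group G
    using assms(1) by (rule closed_perm_group_of_subgroup)
  show ?thesis
    using assms(2) ample_generics_imp_generic[OF assms(3)] by (rule bergman_property_if_generic_tuples)
qed

end
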